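(* Let $(M,\mathcal I)$ be the hyperbolic Monge-Ampère system on a $5$-manifold $M$ with differential ideal $\mathcal I=\langle\theta^0,\theta^1\wedge\theta^2,\theta^3\wedge\theta^4\rangle$, where $(\theta^0,\dots,\theta^4)$ is a coframing satisfying $$\begin{aligned} d\theta^0&=-2(\theta^1+\theta^3)\wedge\theta^0+\theta^1\wedge\theta^2+\theta^3\wedge\theta^4,\\ d\theta^1&=-\theta^1\wedge\theta^4+\theta^2\wedge\theta^4+\theta^2\wedge\theta^3,\\ d\theta^2&=-\theta^1\wedge\theta^4+\theta^2\wedge\theta^4+\theta^2\wedge\theta^3-\theta^1\wedge\theta^2+\theta^3\wedge\theta^4,\\ d\theta^3&=\theta^1\wedge\theta^4-\theta^2\wedge\theta^4-\theta^2\wedge\theta^3,\\ d\theta^4&=-\theta^1\wedge\theta^4+\theta^2\wedge\theta^4+\theta^2\wedge\theta^3+\theta^1\wedge\theta^2-\theta^3\wedge\theta^4. \end{aligned}$$ Then, up to a contact transformation, $(M,\mathcal I)$ is equivalent to the hyperbolic Monge-Ampère PDE $$(A^2-B^2)(z_{xx}-z_{yy})+4AB\,z_{xy}=0,\qquad A=2z_x+y,\quad B=2z_y-x.$$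
   Context: The equivalence is local. A Monge-Ampère PDE for $z(x,y)$ is encoded as an exterior differential system on an open subset of $\mathbb R^5$ with coordinates $(x,y,z,p,q)$ generated by the contact form $dz-p\,dx-q\,dy$, its exterior derivative, and a $2$-form $\Omega$ whose vanishing on surfaces $z=z(x,y),\ p=z_x,\ q=z_y$ (with $dx\wedge dy\neq0$) is the PDE. Here this is on the open set where $A=2p+y$ and $B=2q-x$ do not vanish simultaneously. Two systems are equivalent up to a contact transformation if there is a local diffeomorphism carrying one differential ideal to the other. *)

theory Defs
  imports "HOL-Analysis.Analysis" "HOL-Library.Function_Algebras"
begin

section \<open>Smooth functions on open subsets of normed spaces\<close>

text \<open>Meaningful for open \<open>S\<close>: \<open>f\<close> is \<open>k\<close> times continuously differentiable on \<open>S\<close>.\<close>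

fun Ck_on :: "nat \<Rightarrow> 'a::real_normed_vector set \<Rightarrow> ('a \<Rightarrow> 'b::real_normed_vector) \<Rightarrow> bool" where
  "Ck_on 0 S f \<longleftrightarrow> continuous_on S f"
| "Ck_on (Suc k) S f \<longleftrightarrow> (\<forall>x\<in>S. f differentiable (at x)) \<and>
     (\<forall>v. Ck_on k S (\<lambda>x. frechet_derivative f (at x) v))"

definition smooth_on :: "'a::real_normed_vector set \<Rightarrow> ('a \<Rightarrow> 'b::real_normed_vector) \<Rightarrow> bool" where
  "smooth_on S f \<longleftrightarrow> (\<forall>k. Ck_on k S f)"


section \<open>Differential forms on open subsets of Euclidean space\<close>

text \<open>
  A (not necessarily homogeneous) differential form assigns to a point \<open>x\<close> and a list \<open>vs\<close> of
  tangent vectors a real number; the restriction to lists of length \<open>k\<close> is the component of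
  degree \<open>k\<close>. Forms on \<open>S\<close> vanish off \<open>S\<close> by convention, so that equality of forms on \<open>S\<close> is
  equality of functions.
\<close>

type_synonym 'e dform = "'e \<Rightarrow> 'e list \<Rightarrow> real"

definition dforms_on :: "'e::euclidean_space set \<Rightarrow> 'e dform set" where
  "dforms_on S = {\<omega>.
     (\<forall>x vs. x \<notin> S \<longrightarrow> \<omega> x vs = 0) \<and>
     (\<forall>x\<in>S. \<forall>vs. \<forall>i<length vs. linear (\<lambda>v. \<omega> x (vs[i := v]))) \<and>
     (\<forall>x\<in>S. \<forall>vs. \<forall>i<length vs. \<forall>j<length vs. i \<noteq> j \<and> vs ! i = vs ! j \<longrightarrow> \<omega> x vs = 0) \<and>
     (\<forall>vs. smooth_on S (\<lambda>x. \<omega> x vs))}"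

text \<open>
  Normalisation: \<open>(\<alpha> \<and> \<beta>)(v, w) = \<alpha>(v) \<beta>(w) - \<alpha>(w) \<beta>(v)\<close> for 1-forms, which is the one matching
  \<open>d\<theta>(v, w) = v(\<theta>(w)) - w(\<theta>(v))\<close> below (for constant \<open>v\<close>, \<open>w\<close>). The summand \<open>k\<close> is the
  product of the degree \<open>k\<close> component of \<open>\<alpha>\<close> with the complementary component of \<open>\<beta>\<close>.
\<close>

definition wedge :: "'e dform \<Rightarrow> 'e dform \<Rightarrow> 'e dform" (infixl "\<and>\<^sub>E" 75) where
  "\<alpha> \<and>\<^sub>E \<beta> = (\<lambda>x vs. let n = length vs in
     \<Sum>k\<le>n. (\<Sum>\<sigma> | \<sigma> permutes {..<n}. of_int (sign \<sigma>) *
       \<alpha> x (map (\<lambda>i. vs ! \<sigma> i) [0..<k]) * \<beta> x (map (\<lambda>i. vs ! \<sigma> i) [k..<n]))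
     / (fact k * fact (n - k)))"

definition ext_deriv :: "'e::euclidean_space set \<Rightarrow> 'e dform \<Rightarrow> 'e dform" where
  "ext_deriv S \<omega> = (\<lambda>x vs. if x \<in> S
     then \<Sum>i<length vs. (-1) ^ i *
       frechet_derivative (\<lambda>y. \<omega> y (take i vs @ drop (Suc i) vs)) (at x) (vs ! i)
     else 0)"

definition pullback ::
  "('d::real_normed_vector \<Rightarrow> 'e::real_normed_vector) \<Rightarrow> 'e dform \<Rightarrow> 'd dform" where
  "pullback f \<omega> = (\<lambda>x vs. \<omega> (f x) (map (frechet_derivative f (at x)) vs))"

definition fscale :: "('e \<Rightarrow> real) \<Rightarrow> 'e dform \<Rightarrow> 'e dform" where
  "fscale f \<omega> = (\<lambda>x vs. f x * \<omega> x vs)"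


section \<open>Smooth manifolds and differential forms on them\<close>

text \<open>A chart \<open>(U, \<phi>)\<close> consists of its domain and its coordinate map.\<close>

type_synonym ('m, 'e) chart = "'m set \<times> ('m \<Rightarrow> 'e)"

text \<open>The map \<open>F\<close> read in the chart \<open>c\<close> of its source and the chart \<open>d\<close> of its target.\<close>

definition local_rep ::
  "('m, 'd) chart \<Rightarrow> ('m \<Rightarrow> 'n) \<Rightarrow> ('n, 'e) chart \<Rightarrow> 'd \<Rightarrow> 'e" where
  "local_rep c F d = snd d \<circ> F \<circ> inv_into (fst c) (snd c)"

text \<open>
  \<open>smooth_map A B W F\<close> is only used for \<open>F\<close> that are continuous on the open set \<open>W\<close>, so that the
  sets on which the local representatives are required to be smooth are open.
\<close>

definition smooth_map ::
  "('m, 'd::euclidean_space) chart set \<Rightarrow> ('n, 'e::euclidean_space) chart set \<Rightarrow>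
    'm set \<Rightarrow> ('m \<Rightarrow> 'n) \<Rightarrow> bool" where
  "smooth_map A B W F \<longleftrightarrow> (\<forall>c\<in>A. \<forall>d\<in>B.
     smooth_on (snd c ` (fst c \<inter> W \<inter> F -` fst d)) (local_rep c F d))"

text \<open>
  A manifold without boundary of dimension \<open>DIM('e)\<close>; the smoothness of the identity expresses
  that all transition maps are smooth.
\<close>

definition smooth_manifold :: "'m topology \<Rightarrow> ('m, 'e::euclidean_space) chart set \<Rightarrow> bool" where
  "smooth_manifold X A \<longleftrightarrow>
     Hausdorff_space X \<and> second_countable X \<and>
     \<Union> (fst ` A) = topspace X \<and>
     (\<forall>(U, \<phi>)\<in>A. openin X U \<and> open (\<phi> ` U) \<and>
        homeomorphic_map (subtopology X U) (top_of_set (\<phi> ` U)) \<phi>) \<and>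
     smooth_map A A (topspace X) id"

definition diffeomorphism ::
  "'m topology \<Rightarrow> ('m, 'd::euclidean_space) chart set \<Rightarrow> 'm set \<Rightarrow>
   'n topology \<Rightarrow> ('n, 'e::euclidean_space) chart set \<Rightarrow> 'n set \<Rightarrow> ('m \<Rightarrow> 'n) \<Rightarrow> bool" where
  "diffeomorphism X A W Y B V F \<longleftrightarrow>
     homeomorphic_map (subtopology X W) (subtopology Y V) F \<and>
     smooth_map A B W F \<and> smooth_map B A V (inv_into W F)"

text \<open>
  A differential form on a manifold is given by its local representatives in the charts of the
  atlas.
\<close>

type_synonym ('m, 'e) mform = "('m, 'e) chart \<Rightarrow> 'e dform"

text \<open>\<open>is_pullback A B W F \<omega> \<eta>\<close>: on \<open>W\<close> the form \<open>\<omega>\<close> is the pullback of \<open>\<eta>\<close> along \<open>F\<close>.\<close>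

definition is_pullback ::
  "('m, 'd::euclidean_space) chart set \<Rightarrow> ('n, 'e::euclidean_space) chart set \<Rightarrow>
    'm set \<Rightarrow> ('m \<Rightarrow> 'n) \<Rightarrow> ('m, 'd) mform \<Rightarrow> ('n, 'e) mform \<Rightarrow> bool" where
  "is_pullback A B W F \<omega> \<eta> \<longleftrightarrow> (\<forall>c\<in>A. \<forall>d\<in>B. \<forall>x\<in>snd c ` (fst c \<inter> W \<inter> F -` fst d).
     \<omega> c x = pullback (local_rep c F d) (\<eta> d) x)"

text \<open>
  The smooth forms on the open subset \<open>W\<close> of a manifold with atlas \<open>A\<close>. The last conjunct says
  that the local representatives transform into each other under changes of charts.
\<close>

definition mforms :: "('m, 'e::euclidean_space) chart set \<Rightarrow> 'm set \<Rightarrow> ('m, 'e) mform set" where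
  "mforms A W = {\<omega>.
     (\<forall>c. c \<notin> A \<longrightarrow> \<omega> c = 0) \<and>
     (\<forall>c\<in>A. \<omega> c \<in> dforms_on (snd c ` (fst c \<inter> W))) \<and>
     is_pullback A A W id \<omega> \<omega>}"

definition homogeneous :: "nat \<Rightarrow> ('m, 'e) mform \<Rightarrow> bool" where
  "homogeneous k \<omega> \<longleftrightarrow> (\<forall>c x vs. length vs \<noteq> k \<longrightarrow> \<omega> c x vs = 0)"

definition mwedge :: "('m, 'e) mform \<Rightarrow> ('m, 'e) mform \<Rightarrow> ('m, 'e) mform" (infixl "\<and>\<^sub>M" 75) where
  "\<alpha> \<and>\<^sub>M \<beta> = (\<lambda>c. \<alpha> c \<and>\<^sub>E \<beta> c)"

definition mscale :: "real \<Rightarrow> ('m, 'e) mform \<Rightarrow> ('m, 'e) mform" (infixr "*\<^sub>M" 77) where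
  "r *\<^sub>M \<omega> = (\<lambda>c x vs. r * \<omega> c x vs)"

text \<open>The exterior derivative of a form that is defined on the whole manifold.\<close>

definition mext_deriv :: "('m, 'e::euclidean_space) mform \<Rightarrow> ('m, 'e) mform" where
  "mext_deriv \<omega> = (\<lambda>c. ext_deriv (snd c ` fst c) (\<omega> c))"

definition mrestrict :: "'m set \<Rightarrow> ('m, 'e) mform \<Rightarrow> ('m, 'e) mform" where
  "mrestrict W \<omega> = (\<lambda>c x vs. if x \<in> snd c ` (fst c \<inter> W) then \<omega> c x vs else 0)"

definition coframing ::
  "('m, 'e::euclidean_space) chart set \<Rightarrow> 'm set \<Rightarrow> (nat \<Rightarrow> ('m, 'e) mform) \<Rightarrow> bool" where
  "coframing A M \<theta> \<longleftrightarrow>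
     (\<forall>i<DIM('e). \<theta> i \<in> mforms A M \<and> homogeneous 1 (\<theta> i)) \<and>
     (\<forall>c\<in>A. \<forall>x\<in>snd c ` (fst c \<inter> M). \<forall>a::nat \<Rightarrow> real.
        (\<forall>v. (\<Sum>i<DIM('e). a i * \<theta> i c x [v]) = 0) \<longrightarrow> (\<forall>i<DIM('e). a i = 0))"


section \<open>Exterior differential systems and their local equivalence\<close>

text \<open>
  The two-sided algebraic ideal of the exterior algebra of forms on \<open>W\<close> that is generated by \<open>G\<close>.
  It is a differential ideal if it contains the exterior derivatives of the generators, as is the
  case for the systems considered here.
\<close>

inductive_set generated_ideal ::
  "('m, 'e::euclidean_space) chart set \<Rightarrow> 'm set \<Rightarrow> ('m, 'e) mform set \<Rightarrow> ('m, 'e) mform set"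
  for A W G where
  zero: "0 \<in> generated_ideal A W G"
| gen: "\<omega> \<in> G \<Longrightarrow> \<omega> \<in> generated_ideal A W G"
| add: "\<omega> \<in> generated_ideal A W G \<Longrightarrow> \<eta> \<in> generated_ideal A W G \<Longrightarrow>
    \<omega> + \<eta> \<in> generated_ideal A W G"
| left: "\<alpha> \<in> mforms A W \<Longrightarrow> \<omega> \<in> generated_ideal A W G \<Longrightarrow> \<alpha> \<and>\<^sub>M \<omega> \<in> generated_ideal A W G"
| right: "\<alpha> \<in> mforms A W \<Longrightarrow> \<omega> \<in> generated_ideal A W G \<Longrightarrow> \<omega> \<and>\<^sub>M \<alpha> \<in> generated_ideal A W G"

definition restrict_ideal ::
  "('m, 'e::euclidean_space) chart set \<Rightarrow> 'm set \<Rightarrow> ('m, 'e) mform set \<Rightarrow> ('m, 'e) mform set" where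
  "restrict_ideal A W I = generated_ideal A W (mrestrict W ` I)"

text \<open>
  Every point of \<open>X\<close> has an open neighbourhood \<open>W\<close> with a diffeomorphism onto an open subset
  \<open>V\<close> of \<open>Y\<close> which carries the ideal \<open>I\<close> on \<open>W\<close> to the ideal \<open>J\<close> on \<open>V\<close>.
\<close>

definition locally_equivalent ::
  "'m topology \<Rightarrow> ('m, 'd::euclidean_space) chart set \<Rightarrow> ('m, 'd) mform set \<Rightarrow>
   'n topology \<Rightarrow> ('n, 'e::euclidean_space) chart set \<Rightarrow> ('n, 'e) mform set \<Rightarrow> bool" where
  "locally_equivalent X A I Y B J \<longleftrightarrow> (\<forall>m\<in>topspace X. \<exists>W V F.
     m \<in> W \<and> openin X W \<and> openin Y V \<and> diffeomorphism X A W Y B V F \<and>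
     restrict_ideal A W I =
       {\<omega> \<in> mforms A W. \<exists>\<eta>\<in>restrict_ideal B V J. is_pullback A B W F \<omega> \<eta>})"


section \<open>Monge-Ampere systems on the space of 1-jets\<close>

text \<open>
  The coordinates \<open>(x, y, z, p, q)\<close> of the jet space are the components 1 to 5 of \<open>real ^ 5\<close>.
\<close>

definition dcoord :: "5 \<Rightarrow> (real ^ 5) dform" where
  "dcoord i = (\<lambda>u vs. if length vs = 1 then hd vs $ i else 0)"

definition contact_form :: "(real ^ 5) dform" where
  "contact_form = dcoord 3 - fscale (\<lambda>u. u $ 4) (dcoord 1) - fscale (\<lambda>u. u $ 5) (dcoord 2)"

text \<open>
  The 2-form \<open>a dp \<and> dy + b dx \<and> dp + c dx \<and> dq\<close> of the equation
  \<open>a z\<^sub>x\<^sub>x + b z\<^sub>x\<^sub>y + c z\<^sub>y\<^sub>y = 0\<close>, cf. \<open>monge_ampere_form_jet\<close> below.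
\<close>

definition monge_ampere_form ::
  "(real ^ 5 \<Rightarrow> real) \<Rightarrow> (real ^ 5 \<Rightarrow> real) \<Rightarrow> (real ^ 5 \<Rightarrow> real) \<Rightarrow> (real ^ 5) dform" where
  "monge_ampere_form a b c =
     fscale a (dcoord 4 \<and>\<^sub>E dcoord 2) + fscale b (dcoord 1 \<and>\<^sub>E dcoord 4) +
     fscale c (dcoord 1 \<and>\<^sub>E dcoord 5)"

text \<open>
  An open subset \<open>N\<close> of Euclidean space is a manifold with the single chart \<open>(N, id)\<close>.
\<close>

definition euclidean_mform :: "'e set \<Rightarrow> 'e dform \<Rightarrow> ('e, 'e) mform" where
  "euclidean_mform N \<omega> = (\<lambda>c x vs. if c = (N, id) \<and> x \<in> N then \<omega> x vs else 0)"

definition monge_ampere_ideal ::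
  "(real ^ 5) set \<Rightarrow> (real ^ 5) dform \<Rightarrow> (real ^ 5, real ^ 5) mform set" where
  "monge_ampere_ideal N \<Omega> = generated_ideal {(N, id)} N
     (euclidean_mform N ` {contact_form, ext_deriv UNIV contact_form, \<Omega>})"

definition jet_A :: "real ^ 5 \<Rightarrow> real" where "jet_A u = 2 * u $ 4 + u $ 2"
definition jet_B :: "real ^ 5 \<Rightarrow> real" where "jet_B u = 2 * u $ 5 - u $ 1"

definition pde_domain :: "(real ^ 5) set" where
  "pde_domain = {u. \<not> (jet_A u = 0 \<and> jet_B u = 0)}"

definition pde_form :: "(real ^ 5) dform" where
  "pde_form = monge_ampere_form
     (\<lambda>u. (jet_A u)\<^sup>2 - (jet_B u)\<^sup>2) (\<lambda>u. 4 * jet_A u * jet_B u) (\<lambda>u. - ((jet_A u)\<^sup>2 - (jet_B u)\<^sup>2))"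


subsection \<open>Relation to the partial differential equation\<close>

definition jet ::
  "(real \<times> real \<Rightarrow> real) \<Rightarrow> (real \<times> real \<Rightarrow> real) \<Rightarrow> (real \<times> real \<Rightarrow> real) \<Rightarrow> real \<times> real \<Rightarrow> real ^ 5"
  where "jet z p q w = vector [fst w, snd w, z w, p w, q w]"

lemma UNIV_5: "(UNIV :: 5 set) = {1, 2, 3, 4, 5}"
  by (rule sym, rule card_subset_eq) auto

lemma vector_5 [simp]:
  "(vector [a, b, c, d, e] :: 'a::zero ^ 5) $ 1 = a"
  "(vector [a, b, c, d, e] :: 'a ^ 5) $ 2 = b"
  "(vector [a, b, c, d, e] :: 'a ^ 5) $ 3 = c"
  "(vector [a, b, c, d, e] :: 'a ^ 5) $ 4 = d"
  "(vector [a, b, c, d, e] :: 'a ^ 5) $ 5 = e"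
  unfolding vector_def by simp_all

lemma wedge_1_1:
  assumes "\<And>vs. length vs \<noteq> 1 \<Longrightarrow> \<alpha> x vs = 0" and "\<And>vs. length vs \<noteq> 1 \<Longrightarrow> \<beta> x vs = 0"
  shows "(\<alpha> \<and>\<^sub>E \<beta>) x [v, w] = \<alpha> x [v] * \<beta> x [w] - \<alpha> x [w] * \<beta> x [v]"
proof -
  have n: "length [v, w] = Suc (Suc 0)" by simp
  have P: "{\<sigma>. \<sigma> permutes {..<Suc (Suc 0)}} = {id, Transposition.transpose 0 (Suc 0)}"
    by (auto simp: lessThan_Suc insert_commute permutes_doubleton_iff)
  have t: "id \<noteq> Transposition.transpose 0 (Suc 0)"
    by (metis id_apply nat.distinct(1) Transposition.transpose_apply_first)
  have K: "{..Suc (Suc 0)} = {0, Suc 0, Suc (Suc 0)}" by auto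
  have z: "\<alpha> x [] = 0" "\<beta> x [] = 0" using assms by auto
  show ?thesis
    unfolding wedge_def Let_def n P K using t z
    by (simp add: sign_swap_id)
qed

lemma has_derivative_jet:
  assumes "(z has_derivative z') (at w)" "(p has_derivative p') (at w)" "(q has_derivative q') (at w)"
  shows "(jet z p q has_derivative (\<lambda>v. vector [fst v, snd v, z' v, p' v, q' v])) (at w)"
  unfolding has_derivative_componentwise_within[of "jet z p q"]
proof
  fix b :: "real ^ 5"
  assume "b \<in> Basis"
  then obtain i where b: "b = axis i 1"
    by (auto simp: Basis_vec_def)
  have "i \<in> {1, 2, 3, 4, 5}" unfolding UNIV_5[symmetric] by simp
  then show "((\<lambda>x. jet z p q x \<bullet> b) has_derivative
      (\<lambda>v. vector [fst v, snd v, z' v, p' v, q' v] \<bullet> b)) (at w)"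
    unfolding b using assms
    by (auto simp: jet_def inner_axis intro!: derivative_eq_intros)
qed

lemma monge_ampere_form_jet:
  assumes z: "(z has_derivative (\<lambda>v. p w * fst v + q w * snd v)) (at w)"
    and p: "(p has_derivative (\<lambda>v. r * fst v + s * snd v)) (at w)"
    and q: "(q has_derivative (\<lambda>v. s * fst v + t * snd v)) (at w)"
  shows "pullback (jet z p q) contact_form w [v] = 0"
    and "pullback (jet z p q) (monge_ampere_form a b c) w [(1, 0), (0, 1)] =
      a (jet z p q w) * r + b (jet z p q w) * s + c (jet z p q w) * t"
proof -
  have D: "frechet_derivative (jet z p q) (at w) = (\<lambda>v. vector [fst v, snd v,
      p w * fst v + q w * snd v, r * fst v + s * snd v, s * fst v + t * snd v])"
    using has_derivative_jet[OF z p q] by (rule frechet_derivative_at[symmetric])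
  show "pullback (jet z p q) contact_form w [v] = 0"
    by (simp add: pullback_def D contact_form_def fun_diff_def dcoord_def fscale_def jet_def)
  show "pullback (jet z p q) (monge_ampere_form a b c) w [(1, 0), (0, 1)] =
      a (jet z p q w) * r + b (jet z p q w) * s + c (jet z p q w) * t"
    unfolding pullback_def D monge_ampere_form_def fscale_def plus_fun_apply
    by (simp add: wedge_1_1 dcoord_def)
qed

lemma pde_form_jet:
  assumes "(z has_derivative (\<lambda>v. p w * fst v + q w * snd v)) (at w)"
    and "(p has_derivative (\<lambda>v. r * fst v + s * snd v)) (at w)"
    and "(q has_derivative (\<lambda>v. s * fst v + t * snd v)) (at w)"
  defines "A \<equiv> 2 * p w + snd w" and "B \<equiv> 2 * q w - fst w"
  shows "pullback (jet z p q) pde_form w [(1, 0), (0, 1)] = (A\<^sup>2 - B\<^sup>2) * (r - t) + 4 * A * B * s"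
  unfolding pde_form_def monge_ampere_form_jet(2)[OF assms(1-3)]
  by (simp add: A_def B_def jet_A_def jet_B_def jet_def algebra_simps)

end

theory Submission
  imports Defs
begin

text \<open>
  The structure equations can be integrated by quadratures. Write \<open>s = \<theta>\<^sup>1 + \<theta>\<^sup>3\<close> and
  \<open>\<tau> = \<theta>\<^sup>2 + \<theta>\<^sup>4 - \<theta>\<^sup>1 + \<theta>\<^sup>3\<close>. Both are closed, so locally \<open>s = dS\<close> and \<open>\<tau> = dT\<close>.
  Put \<open>A = exp S cos T\<close> and \<open>B = exp S sin T\<close>. The remaining two directions
  \<open>\<mu> = \<theta>\<^sup>1 - \<theta>\<^sup>3\<close> and \<open>\<nu> = \<theta>\<^sup>4 - \<theta>\<^sup>2 + \<theta>\<^sup>1 + \<theta>\<^sup>3\<close> satisfy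
  \<open>d(\<mu> + i \<nu>) = - (s + i \<tau>) \<and> (\<mu> + i \<nu>)\<close>; the integrating factor \<open>A + i B\<close> makes
  \<open>(A + i B)(\<mu> + i \<nu>)\<close> closed, hence equal to \<open>dU + i dV\<close>. Finally, with
  \<open>\<rho> = (A\<^sup>2 + B\<^sup>2)/2\<close>, one has \<open>d(\<rho> \<theta>\<^sup>0) = \<rho> (\<theta>\<^sup>1 \<and> \<theta>\<^sup>2 + \<theta>\<^sup>3 \<and> \<theta>\<^sup>4)\<close>, which up to sign is
  \<open>dp \<and> dx + dq \<and> dy\<close> for the linear functions
  \<open>x = (U - B)/2, y = (A + V)/2, p = (A - V)/4, q = (U + B)/4\<close> of \<open>A, B, U, V\<close>; so
  \<open>\<rho> \<theta>\<^sup>0 + p dx + q dy\<close> is closed and is \<open>dz\<close> for a fifth function \<open>z\<close>.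
  The choice of \<open>x, y, p, q\<close> is such that \<open>A = 2 p + y\<close> and \<open>B = 2 q - x\<close>.

  The map \<open>G = (x, y, z, p, q)\<close> is a local diffeomorphism into the domain of the equation. It
  pulls the contact form back to \<open>\<rho> \<theta>\<^sup>0\<close>, and it pulls the exterior derivative of the contact form
  and the 2-form of the equation back to two combinations of \<open>\<theta>\<^sup>1 \<and> \<theta>\<^sup>2\<close> and \<open>\<theta>\<^sup>3 \<and> \<theta>\<^sup>4\<close> whose
  determinant does not vanish. Both ideals are therefore the same. This computation is
  \<open>coframing_normal_form\<close>; it rests on the Poincare lemma \<open>Poincare_1_form\<close> and on
  \<open>smooth_inverse_function_theorem\<close>.

  To pass from this statement about one chart to ideals of forms on a manifold, let \<open>F\<close> be the
  composition of the chart with \<open>G\<close>. Pullback along \<open>F\<close> is a bijective homomorphism from the forms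
  on the target to the forms on the chart domain \<open>W\<close>; the locale \<open>chart_equivalence\<close> proves what is
  needed of this, in particular surjectivity (\<open>pull_surj\<close>). Hence the transported ideal is
  generated by the pullbacks of the generators, and \<open>pull_equivalence\<close> reduces equality of ideals to
  membership of finitely many generators. Since a form on \<open>W\<close> is determined by its representative in
  the one chart, each membership is checked pointwise there.
\<close>


section \<open>Calculus of continuously differentiable and smooth functions\<close>

lemma Ck_on_Suc_lower: "Ck_on (Suc k) S f \<Longrightarrow> Ck_on k S f"
proof (induction k arbitrary: f)
  case 0
  then show ?case
    by (auto intro!: continuous_at_imp_continuous_on differentiable_imp_continuous_within)
next
  case (Suc k)
  then show ?case by (auto simp del: Ck_on.simps(1))
qed

lemma Ck_on_cong:
  assumes "open S" "\<And>x. x \<in> S \<Longrightarrow> f x = g x" "Ck_on k S f"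
  shows "Ck_on k S g"
  using assms(2,3)
proof (induction k arbitrary: f g)
  case 0
  then show ?case using continuous_on_cong by force
next
  case (Suc k)
  have D: "(f has_derivative f') (at x) \<longleftrightarrow> (g has_derivative f') (at x)" if "x \<in> S" for x f'
    using has_derivative_transform_within_open[OF _ \<open>open S\<close> that] Suc.prems(1) by metis
  have 1: "g differentiable (at x)" if "x \<in> S" for x
    using Suc.prems(2) D[OF that] that by (metis Ck_on.simps(2) differentiable_def)
  have 2: "frechet_derivative f (at x) = frechet_derivative g (at x)" if "x \<in> S" for x
    using D[OF that] by (simp add: frechet_derivative_def)
  have "Ck_on k S (\<lambda>x. frechet_derivative g (at x) v)" for v
    by (rule Suc.IH[of "\<lambda>x. frechet_derivative f (at x) v"]) (use Suc.prems 2 in auto)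
  then show ?case using 1 by simp
qed

text \<open>
  \<^const>\<open>Ck_on\<close> speaks of the derivative that \<^const>\<open>frechet_derivative\<close> chooses; this rule admits any
  explicit expression that has been proved to be the derivative.
\<close>
lemma Ck_on_SucI:
  assumes "open S" "\<And>x. x \<in> S \<Longrightarrow> (f has_derivative f' x) (at x)"
    and "\<And>v. Ck_on k S (\<lambda>x. f' x v)"
  shows "Ck_on (Suc k) S f"
proof -
  have "Ck_on k S (\<lambda>x. frechet_derivative f (at x) v)" for v
    by (rule Ck_on_cong[OF assms(1) _ assms(3)[of v]])
      (use frechet_derivative_at[OF assms(2)] in metis)
  then show ?thesis using assms(2) by (auto simp: differentiable_def)
qed

lemma Ck_on_Suc_derivative:
  assumes "Ck_on (Suc k) S f" "x \<in> S"
  shows "(f has_derivative frechet_derivative f (at x)) (at x)"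
  using assms by (simp add: frechet_derivative_works)

lemma Ck_on_subset: "Ck_on k S f \<Longrightarrow> T \<subseteq> S \<Longrightarrow> Ck_on k T f"
  by (induction k arbitrary: f) (auto intro: continuous_on_subset)

lemma Ck_on_const: "Ck_on k S (\<lambda>x. c)"
  by (induction k arbitrary: c) auto

lemma Ck_on_bounded_linear:
  assumes "open S" "bounded_linear h" "Ck_on k S f"
  shows "Ck_on k S (\<lambda>x. h (f x))"
  using assms(3)
proof (induction k arbitrary: f)
  case 0
  then show ?case using bounded_linear.continuous_on[OF assms(2)] by simp
next
  case (Suc k)
  show ?case
  proof (rule Ck_on_SucI[OF assms(1)])
    show "((\<lambda>x. h (f x)) has_derivative (\<lambda>v. h (frechet_derivative f (at x) v))) (at x)"
      if "x \<in> S" for x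
      using bounded_linear.has_derivative[OF assms(2) Ck_on_Suc_derivative[OF Suc.prems that]] .
  qed (use Suc in auto)
qed

lemma Ck_on_add:
  assumes "open S" "Ck_on k S f" "Ck_on k S g"
  shows "Ck_on k S (\<lambda>x. f x + g x)"
  using assms(2,3)
proof (induction k arbitrary: f g)
  case 0
  then show ?case by (auto intro: continuous_on_add)
next
  case (Suc k)
  show ?case
  proof (rule Ck_on_SucI[OF assms(1)])
    show "((\<lambda>x. f x + g x) has_derivative
        (\<lambda>v. frechet_derivative f (at x) v + frechet_derivative g (at x) v)) (at x)"
      if "x \<in> S" for x
      by (intro has_derivative_add Ck_on_Suc_derivative[OF Suc.prems(1) that]
          Ck_on_Suc_derivative[OF Suc.prems(2) that])
  qed (use Suc in auto)
qed

lemma Ck_on_sum: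
  assumes "open S" "\<And>i. i \<in> I \<Longrightarrow> Ck_on k S (f i)"
  shows "Ck_on k S (\<lambda>x. \<Sum>i\<in>I. f i x)"
  using assms(2)
  by (induction I rule: infinite_finite_induct) (auto intro: Ck_on_add[OF assms(1)] Ck_on_const)

text \<open>
  The product rule expresses the derivative by two terms of the same kind with one factor
  differentiated once, so the induction runs over all pairs of functions at once.
\<close>
lemma Ck_on_bilinear:
  assumes "open S" "bounded_bilinear h" "Ck_on k S f" "Ck_on k S g"
  shows "Ck_on k S (\<lambda>x. h (f x) (g x))"
  using assms(3,4)
proof (induction k arbitrary: f g)
  case 0
  then show ?case by (auto intro: bounded_bilinear.continuous_on[OF assms(2)])
next
  case (Suc k)
  show ?case
  proof (rule Ck_on_SucI[OF assms(1)])
    show "((\<lambda>x. h (f x) (g x)) has_derivative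
        (\<lambda>v. h (f x) (frechet_derivative g (at x) v) + h (frechet_derivative f (at x) v) (g x))) (at x)"
      if "x \<in> S" for x
      by (intro bounded_bilinear.FDERIV[OF assms(2)] Ck_on_Suc_derivative[OF Suc.prems(1) that]
          Ck_on_Suc_derivative[OF Suc.prems(2) that])
    show "Ck_on k S (\<lambda>x. h (f x) (frechet_derivative g (at x) v) +
        h (frechet_derivative f (at x) v) (g x))" for v
      using Suc.prems
      by (intro Ck_on_add[OF assms(1)] Suc.IH Ck_on_Suc_lower[OF Suc.prems(1)]
          Ck_on_Suc_lower[OF Suc.prems(2)]) auto
  qed
qed

lemma Ck_on_prod:
  fixes f :: "'i \<Rightarrow> 'a::real_normed_vector \<Rightarrow> real"
  assumes "open S" "\<And>i. i \<in> I \<Longrightarrow> Ck_on k S (f i)"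
  shows "Ck_on k S (\<lambda>x. \<Prod>i\<in>I. f i x)"
  using assms(2)
  by (induction I rule: infinite_finite_induct)
    (auto intro: Ck_on_bilinear[OF assms(1) bounded_bilinear_mult] Ck_on_const)

lemma Ck_on_inverse:
  fixes f :: "'a::real_normed_vector \<Rightarrow> real"
  assumes "open S" "Ck_on k S f" "\<And>x. x \<in> S \<Longrightarrow> f x \<noteq> 0"
  shows "Ck_on k S (\<lambda>x. inverse (f x))"
  using assms(2)
proof (induction k)
  case 0
  then show ?case using assms(3) by (auto intro: continuous_on_inverse)
next
  case (Suc k)
  show ?case
  proof (rule Ck_on_SucI[OF assms(1)])
    show "((\<lambda>x. inverse (f x)) has_derivative
        (\<lambda>v. (- 1) * (inverse (f x) * (frechet_derivative f (at x) v * inverse (f x))))) (at x)"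
      if "x \<in> S" for x
      using Deriv.has_derivative_inverse[OF assms(3)[OF that] Ck_on_Suc_derivative[OF Suc.prems that]]
      by (simp add: mult.assoc)
    show "Ck_on k S (\<lambda>x. (- 1) * (inverse (f x) * (frechet_derivative f (at x) v * inverse (f x))))" for v
      using Suc.prems
      by (intro Ck_on_bilinear[OF assms(1) bounded_bilinear_mult] Suc.IH Ck_on_const
          Ck_on_Suc_lower[OF Suc.prems]) auto
  qed
qed

lemma linear_euclidean_expansion:
  fixes f :: "'a::euclidean_space \<Rightarrow> 'b::real_normed_vector"
  assumes "linear f"
  shows "f v = (\<Sum>b\<in>Basis. (v \<bullet> b) *\<^sub>R f b)"
  by (subst euclidean_representation[symmetric, of v])
    (simp only: linear_sum[OF assms] linear_scale[OF assms])

text \<open>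
  \<^const>\<open>Ck_on\<close> only speaks of derivatives in fixed directions, whereas the chain rule evaluates the
  derivative of \<open>f\<close> in the direction \<open>Dg(x) v\<close>, which depends on \<open>x\<close>. Expanding this direction in
  the basis of the finite-dimensional middle space gives a sum of products.
\<close>
lemma Ck_on_compose:
  fixes g :: "'a::real_normed_vector \<Rightarrow> 'b::euclidean_space"
    and f :: "'b \<Rightarrow> 'c::real_normed_vector"
  assumes "open S" "open T" "g ` S \<subseteq> T" "Ck_on k T f" "Ck_on k S g"
  shows "Ck_on k S (\<lambda>x. f (g x))"
  using assms(4,5)
proof (induction k arbitrary: f)
  case 0
  then show ?case using continuous_on_compose2[OF _ _ assms(3)] by auto
next
  case (Suc k)
  have gx: "g x \<in> T" if "x \<in> S" for x using assms(3) that by auto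
  show ?case
  proof (rule Ck_on_SucI[OF assms(1)])
    show "((\<lambda>x. f (g x)) has_derivative (\<lambda>v. \<Sum>b\<in>Basis.
        (frechet_derivative g (at x) v \<bullet> b) *\<^sub>R frechet_derivative f (at (g x)) b)) (at x)"
      if "x \<in> S" for x
    proof -
      have "linear (frechet_derivative f (at (g x)))"
        using Ck_on_Suc_derivative[OF Suc.prems(1) gx[OF that]] has_derivative_linear by blast
      note e = linear_euclidean_expansion[OF this]
      show ?thesis
        unfolding e[symmetric]
        using diff_chain_at[OF Ck_on_Suc_derivative[OF Suc.prems(2) that]
            Ck_on_Suc_derivative[OF Suc.prems(1) gx[OF that]]]
        by (simp add: o_def)
    qed
    show "Ck_on k S (\<lambda>x. \<Sum>b\<in>Basis.
        (frechet_derivative g (at x) v \<bullet> b) *\<^sub>R frechet_derivative f (at (g x)) b)" for v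
      using Suc.prems
      by (intro Ck_on_sum[OF assms(1)] Ck_on_bilinear[OF assms(1) bounded_bilinear_scaleR] Suc.IH
          Ck_on_bounded_linear[OF assms(1) bounded_linear_inner_left] Ck_on_Suc_lower[OF Suc.prems(2)])
        auto
  qed
qed

lemma smooth_on_cong: "open S \<Longrightarrow> (\<And>x. x \<in> S \<Longrightarrow> f x = g x) \<Longrightarrow> smooth_on S f \<Longrightarrow> smooth_on S g"
  unfolding smooth_on_def using Ck_on_cong by blast

lemma smooth_on_subset: "smooth_on S f \<Longrightarrow> T \<subseteq> S \<Longrightarrow> smooth_on T f"
  unfolding smooth_on_def using Ck_on_subset by blast

lemma smooth_on_const: "smooth_on S (\<lambda>x. c)"
  unfolding smooth_on_def by (simp add: Ck_on_const)

lemma smooth_on_bounded_linear: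
  "open S \<Longrightarrow> bounded_linear h \<Longrightarrow> smooth_on S f \<Longrightarrow> smooth_on S (\<lambda>x. h (f x))"
  unfolding smooth_on_def using Ck_on_bounded_linear by blast

lemma smooth_on_bilinear:
  "open S \<Longrightarrow> bounded_bilinear h \<Longrightarrow> smooth_on S f \<Longrightarrow> smooth_on S g \<Longrightarrow> smooth_on S (\<lambda>x. h (f x) (g x))"
  unfolding smooth_on_def using Ck_on_bilinear by blast

lemma smooth_on_compose:
  fixes g :: "'a::real_normed_vector \<Rightarrow> 'b::euclidean_space"
  shows "open S \<Longrightarrow> open T \<Longrightarrow> g ` S \<subseteq> T \<Longrightarrow> smooth_on T f \<Longrightarrow> smooth_on S g \<Longrightarrow>
    smooth_on S (\<lambda>x. f (g x))"
  unfolding smooth_on_def using Ck_on_compose by blast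

lemma smooth_on_sum:
  "open S \<Longrightarrow> (\<And>i. i \<in> I \<Longrightarrow> smooth_on S (f i)) \<Longrightarrow> smooth_on S (\<lambda>x. \<Sum>i\<in>I. f i x)"
  unfolding smooth_on_def by (simp add: Ck_on_sum)

lemma smooth_on_add:
  "open S \<Longrightarrow> smooth_on S f \<Longrightarrow> smooth_on S g \<Longrightarrow> smooth_on S (\<lambda>x. f x + g x)"
  unfolding smooth_on_def by (simp add: Ck_on_add)

lemma smooth_on_mult:
  fixes f :: "'a::real_normed_vector \<Rightarrow> real"
  shows "open S \<Longrightarrow> smooth_on S f \<Longrightarrow> smooth_on S g \<Longrightarrow> smooth_on S (\<lambda>x. f x * g x)"
  by (rule smooth_on_bilinear[OF _ bounded_bilinear_mult])

lemma smooth_on_diff: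
  fixes f :: "'a::real_normed_vector \<Rightarrow> real"
  assumes "open S" "smooth_on S f" "smooth_on S g" shows "smooth_on S (\<lambda>x. f x - g x)"
  using smooth_on_add[OF assms(1,2) smooth_on_mult[OF assms(1) smooth_on_const[of S "-1"] assms(3)]]
  by simp

lemma smooth_on_divide:
  fixes f :: "'a::real_normed_vector \<Rightarrow> real"
  assumes "open S" "smooth_on S f" "smooth_on S g" "\<And>x. x \<in> S \<Longrightarrow> g x \<noteq> 0"
  shows "smooth_on S (\<lambda>x. f x / g x)"
  using assms Ck_on_inverse[OF assms(1) _ assms(4)] smooth_on_mult[OF assms(1,2), of "\<lambda>x. inverse (g x)"]
  by (auto simp: smooth_on_def divide_inverse)

lemma smooth_on_derivative:
  assumes "smooth_on S f" "x \<in> S"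
  shows "(f has_derivative frechet_derivative f (at x)) (at x)"
  by (rule Ck_on_Suc_derivative[OF assms(1)[unfolded smooth_on_def, rule_format, of "Suc 0"] assms(2)])

lemma smooth_on_frechet_derivative: 
  "smooth_on S f \<Longrightarrow> smooth_on S (\<lambda>x. frechet_derivative f (at x) v)"
  unfolding smooth_on_def
proof
  fix k
  assume "\<forall>k. Ck_on k S f"
  then have "Ck_on (Suc k) S f" ..
  then show "Ck_on k S (\<lambda>x. frechet_derivative f (at x) v)" by simp
qed

lemma smooth_on_imp_continuous_on: "smooth_on S f \<Longrightarrow> continuous_on S f"
  unfolding smooth_on_def by (drule spec[of _ 0]) simp

text \<open>
  This is how smoothness of primitives is obtained: a function whose differential has smooth
  coefficients gains one order of differentiability over them.
\<close>
lemma smooth_on_derivI: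
  assumes "open S" "\<And>x. x \<in> S \<Longrightarrow> (f has_derivative f' x) (at x)"
    and "\<And>v. smooth_on S (\<lambda>x. f' x v)"
  shows "smooth_on S f"
  unfolding smooth_on_def
proof
  fix k
  have "Ck_on (Suc k) S f"
    using Ck_on_SucI[OF assms(1,2)] assms(3) by (simp add: smooth_on_def)
  then show "Ck_on k S f" by (rule Ck_on_Suc_lower)
qed

lemma smooth_on_id: "open S \<Longrightarrow> smooth_on S (\<lambda>x. x)"
  by (rule smooth_on_derivI[of _ _ "\<lambda>x v. v"]) (auto simp: smooth_on_const)

lemma smooth_on_euclidean_componentwise:
  fixes f :: "'a::real_normed_vector \<Rightarrow> 'b::euclidean_space"
  assumes "open S" "\<And>b. b \<in> Basis \<Longrightarrow> smooth_on S (\<lambda>x. f x \<bullet> b)"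
  shows "smooth_on S f"
proof -
  have "smooth_on S (\<lambda>x. \<Sum>b\<in>Basis. (f x \<bullet> b) *\<^sub>R b)"
    by (rule smooth_on_sum[OF assms(1)])
      (rule smooth_on_bilinear[OF assms(1) bounded_bilinear_scaleR assms(2) smooth_on_const])
  then show ?thesis by (simp add: euclidean_representation)
qed

lemma smooth_on_vec_componentwise:
  fixes f :: "'a::real_normed_vector \<Rightarrow> real ^ 'n"
  assumes "open S" "\<And>i. smooth_on S (\<lambda>x. f x $ i)"
  shows "smooth_on S f"
  by (rule smooth_on_euclidean_componentwise[OF assms(1)])
    (auto simp: Basis_vec_def inner_axis assms(2))

lemma smooth_on_vec_nth:
  fixes f :: "'a::real_normed_vector \<Rightarrow> real ^ 'n"
  assumes "open S" "smooth_on S f" shows "smooth_on S (\<lambda>x. f x $ i)"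
  by (rule smooth_on_bounded_linear[OF assms(1) bounded_linear_vec_nth assms(2)])

section \<open>Closed 1-forms on convex open sets\<close>

text \<open>
  The exterior derivative of a 1-form \<open>a\<close>, with \<open>a\<close> given as a function of point and vector.
\<close>
definition curl :: "('a::real_normed_vector \<Rightarrow> 'a \<Rightarrow> real) \<Rightarrow> 'a \<Rightarrow> 'a \<Rightarrow> 'a \<Rightarrow> real" where
  "curl a x v w =
    frechet_derivative (\<lambda>y. a y w) (at x) v - frechet_derivative (\<lambda>y. a y v) (at x) w"

lemma curl_eqI:
  assumes "\<And>w. ((\<lambda>y. a y w) has_derivative a' w) (at x)"
  shows "curl a x v w = a' w v - a' v w"
  unfolding curl_def by (simp add: frechet_derivative_at[OF assms, symmetric])

lemma curl_add:
  assumes "\<And>v. smooth_on S (\<lambda>x. a x v)" "\<And>v. smooth_on S (\<lambda>x. b x v)" "x \<in> S"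
  shows "curl (\<lambda>y v. a y v + b y v) x v w = curl a x v w + curl b x v w"
  by (subst curl_eqI[OF has_derivative_add[OF smooth_on_derivative[OF assms(1,3)]
          smooth_on_derivative[OF assms(2,3)]]]) (simp add: curl_def)

lemma curl_diff:
  assumes "\<And>v. smooth_on S (\<lambda>x. a x v)" "\<And>v. smooth_on S (\<lambda>x. b x v)" "x \<in> S"
  shows "curl (\<lambda>y v. a y v - b y v) x v w = curl a x v w - curl b x v w"
  by (subst curl_eqI[OF has_derivative_diff[OF smooth_on_derivative[OF assms(1,3)]
          smooth_on_derivative[OF assms(2,3)]]]) (simp add: curl_def)

lemma curl_mult:
  assumes "(f has_derivative f') (at x)" "\<And>v. smooth_on S (\<lambda>x. a x v)" "x \<in> S"
  shows "curl (\<lambda>y v. f y * a y v) x v w = f' v * a x w - f' w * a x v + f x * curl a x v w"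
  by (subst curl_eqI[OF has_derivative_mult[OF assms(1) smooth_on_derivative[OF assms(2,3)]]])
    (simp add: curl_def algebra_simps)

text \<open>
  The primitive is the integral of \<open>a\<close> along the segments from a fixed point \<open>c\<close>. By closedness the
  derivative of the integrand in direction \<open>v\<close> is \<open>d/dt (t a(c + t (x - c)) v)\<close>, which
  integrates to \<open>a x v\<close>.
\<close>
lemma Poincare_1_form:
  fixes a :: "'a::euclidean_space \<Rightarrow> 'a \<Rightarrow> real"
  assumes "open D" "convex D"
    and smooth: "\<And>v. smooth_on D (\<lambda>x. a x v)"
    and lin: "\<And>x. x \<in> D \<Longrightarrow> linear (a x)"
    and closed: "\<And>x v w. x \<in> D \<Longrightarrow> curl a x v w = 0"
  obtains f where "\<And>x. x \<in> D \<Longrightarrow> (f has_derivative a x) (at x)" "smooth_on D f"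
proof (cases "D = {}")
  case True
  then show ?thesis using that[of "\<lambda>_. 0"] by (simp add: smooth_on_const)
next
  case False
  then obtain c where c: "c \<in> D" by auto
  define \<gamma> where "\<gamma> x t = c + t *\<^sub>R (x - c)" for x and t :: real
  define a' where "a' w x v = frechet_derivative (\<lambda>y. a y w) (at x) v" for w x v
  have \<gamma>_in: "\<gamma> x t \<in> D" if "x \<in> D" "t \<in> {0..1}" for x t
  proof -
    have "\<gamma> x t = (1 - t) *\<^sub>R c + t *\<^sub>R x" by (simp add: \<gamma>_def algebra_simps)
    then show ?thesis using convexD[OF \<open>convex D\<close> c that(1), of "1 - t" t] that(2) by simp
  qed
  have a': "((\<lambda>y. a y w) has_derivative a' w x) (at x)" if "x \<in> D" for w x
    unfolding a'_def using smooth_on_derivative[OF smooth that] by (simp add: eta_contract_eq)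
  have a'_lin: "linear (a' w x)" if "x \<in> D" for w x
    using a'[OF that] has_derivative_linear by blast
  have cont_a: "continuous_on D (\<lambda>x. a x v)" for v
    by (rule smooth_on_imp_continuous_on[OF smooth])
  have cont_a': "continuous_on D (\<lambda>x. a' w x v)" for w v
    unfolding a'_def by (rule smooth_on_imp_continuous_on[OF smooth_on_frechet_derivative[OF smooth]])
  have sym: "a' w x v = a' v x w" if "x \<in> D" for x v w
    using closed[OF that, of v w] by (simp add: curl_def a'_def)
  \<comment> \<open>the derivative in \<open>x\<close> of the integrand \<open>a (\<gamma> x t) (x - c)\<close>\<close>
  define L where "L x t v = a (\<gamma> x t) v +
      t * (\<Sum>b\<in>Basis. ((x - c) \<bullet> b) * a' b (\<gamma> x t) v)" for x t v
  define f where "f x = integral (cbox 0 1) (\<lambda>t. a (\<gamma> x t) (x - c))" for x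
  have L_lin: "linear (L x t)" if "x \<in> D" "t \<in> cbox 0 1" for x t
  proof -
    have "\<gamma> x t \<in> D" using \<gamma>_in that by simp
    note l = lin[OF this] a'_lin[OF this]
    show ?thesis
      unfolding L_def
      by (rule linearI) (simp_all add: linear_add[OF l(1)] linear_add[OF l(2)] linear_scale[OF l(1)]
          linear_scale[OF l(2)] distrib_left sum.distrib sum_distrib_left mult.left_commute)
  qed
  have \<gamma>_cont: "continuous_on X (\<lambda>p. \<gamma> (fst p) (snd p))" for X
    unfolding \<gamma>_def by (intro continuous_intros)
  have cont_comp: "continuous_on (D \<times> cbox 0 1) (\<lambda>p. g (\<gamma> (fst p) (snd p)))"
    if "continuous_on D g" for g :: "'a \<Rightarrow> real"
    by (rule continuous_on_compose2[OF that \<gamma>_cont]) (auto intro: \<gamma>_in)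
  have contL: "continuous_on (D \<times> cbox 0 1) (\<lambda>p. L (fst p) (snd p) v)" for v
    unfolding L_def by (intro continuous_intros cont_comp cont_a cont_a')
  have has: "((\<lambda>x. a (\<gamma> x t) (x - c)) has_derivative L x t) (at x within D)"
    if x: "x \<in> D" and t: "t \<in> cbox 0 1" for x t
  proof (rule has_derivative_transform[OF x])
    have g: "\<gamma> y t \<in> D" if "y \<in> D" for y using \<gamma>_in that t by simp
    show "a (\<gamma> y t) (y - c) = (\<Sum>b\<in>Basis. ((y - c) \<bullet> b) *\<^sub>R a (\<gamma> y t) b)" if "y \<in> D" for y
      by (rule linear_euclidean_expansion[OF lin[OF g[OF that]]])
    have "((\<lambda>y. a (\<gamma> y t) b) has_derivative (\<lambda>v. a' b (\<gamma> x t) (t *\<^sub>R v))) (at x within D)" for b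
    proof -
      have "((\<lambda>y. \<gamma> y t) has_derivative (\<lambda>v. t *\<^sub>R v)) (at x)"
        unfolding \<gamma>_def by (auto intro!: derivative_eq_intros)
      from diff_chain_at[OF this a'[OF g[OF x]]] show ?thesis
        by (auto simp: o_def intro: has_derivative_at_withinI)
    qed
    note d = this
    have e: "L x t = (\<lambda>v. \<Sum>b\<in>Basis. ((x - c) \<bullet> b) *\<^sub>R a' b (\<gamma> x t) (t *\<^sub>R v) + (v \<bullet> b) *\<^sub>R a (\<gamma> x t) b)"
    proof
      fix v
      show "L x t v = (\<Sum>b\<in>Basis. ((x - c) \<bullet> b) *\<^sub>R a' b (\<gamma> x t) (t *\<^sub>R v) + (v \<bullet> b) *\<^sub>R a (\<gamma> x t) b)"
        unfolding L_def linear_euclidean_expansion[OF lin[OF g[OF x]], of v]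
        by (simp add: sum.distrib linear_scale[OF a'_lin[OF g[OF x]]] sum_distrib_left
            mult.left_commute)
    qed
    show "((\<lambda>y. \<Sum>b\<in>Basis. ((y - c) \<bullet> b) *\<^sub>R a (\<gamma> y t) b) has_derivative L x t) (at x within D)"
      unfolding e
      by (rule has_derivative_sum, rule has_derivative_scaleR[OF _ d])
        (auto intro!: derivative_eq_intros)
  qed
  have bl: "blinfun_apply (Blinfun (L x t)) = L x t" if "x \<in> D" "t \<in> cbox 0 1" for x t
    by (rule bounded_linear_Blinfun_apply) (use L_lin[OF that] linear_conv_bounded_linear in blast)
  have contB: "continuous_on (D \<times> cbox 0 1) (\<lambda>(x, t). Blinfun (L x t))"
  proof (rule continuous_on_blinfun_componentwise)
    fix i :: 'a
    show "continuous_on (D \<times> cbox 0 1) (\<lambda>p. blinfun_apply (case p of (x, t) \<Rightarrow> Blinfun (L x t)) i)"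
      by (rule continuous_on_cong[THEN iffD1, OF refl _ contL[of i]]) (auto simp: bl)
  qed
  have deriv: "(f has_derivative a x) (at x)" if x: "x \<in> D" for x
  proof -
    have cont1: "continuous_on (cbox 0 1) (\<lambda>t. a (\<gamma> y t) w)" if "y \<in> D" for y w
      by (rule continuous_on_compose2[OF cont_a[of w]])
        (auto simp: \<gamma>_def intro!: continuous_intros \<gamma>_in[OF that, unfolded \<gamma>_def])
    have "(f has_derivative integral (cbox 0 1) (\<lambda>t. Blinfun (L x t))) (at x within D)"
      unfolding f_def
      by (rule leibniz_rule[OF _ _ contB x \<open>convex D\<close>])
        (auto simp: bl has intro!: integrable_continuous_real cont1[unfolded box_real])
    then have 1: "(f has_derivative integral (cbox 0 1) (\<lambda>t. Blinfun (L x t))) (at x)"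
      using at_within_open[OF x \<open>open D\<close>] by simp
    have "continuous_on (cbox 0 1) (\<lambda>t::real. (x, t))" by (intro continuous_intros)
    then have "continuous_on (cbox 0 1) (\<lambda>t. Blinfun (L x t))"
      using continuous_on_compose2[OF contB, of "cbox 0 1" "\<lambda>t. (x, t)"] x
      by auto
    then have i: "(\<lambda>t. Blinfun (L x t)) integrable_on cbox 0 1"
      by (rule integrable_continuous)
    have "blinfun_apply (integral (cbox 0 1) (\<lambda>t. Blinfun (L x t))) v = a x v" for v
    proof -
      have "blinfun_apply (integral (cbox 0 1) (\<lambda>t. Blinfun (L x t))) v = integral (cbox 0 1) (\<lambda>t. L x t v)"
        unfolding blinfun_apply_integral[OF i] by (rule integral_cong) (simp add: bl[OF x])
      also have "\<dots> = a x v"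
      proof (rule integral_unique)
        have "((\<lambda>t. L x t v) has_integral (1 * a (\<gamma> x 1) v - 0 * a (\<gamma> x 0) v)) {0..1}"
        proof (rule fundamental_theorem_of_calculus)
          fix t :: real
          assume t: "t \<in> {0..1}"
          note g = \<gamma>_in[OF x t]
          have "((\<lambda>t. \<gamma> x t) has_derivative (\<lambda>h. h *\<^sub>R (x - c))) (at t)"
            unfolding \<gamma>_def by (auto intro!: derivative_eq_intros)
          from diff_chain_at[OF this a'[OF g]]
          have "((\<lambda>t. a (\<gamma> x t) v) has_derivative (\<lambda>h. h *\<^sub>R a' v (\<gamma> x t) (x - c))) (at t)"
            by (simp add: o_def linear_scale[OF a'_lin[OF g]])
          then have "((\<lambda>t. t * a (\<gamma> x t) v) has_derivative
              (\<lambda>h. t * (h *\<^sub>R a' v (\<gamma> x t) (x - c)) + h * a (\<gamma> x t) v)) (at t)"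
            by (intro has_derivative_mult) auto
          moreover have "a' v (\<gamma> x t) (x - c) = (\<Sum>b\<in>Basis. ((x - c) \<bullet> b) * a' b (\<gamma> x t) v)"
            by (subst linear_euclidean_expansion[OF a'_lin[OF g]]) (simp add: sym[OF g, of v])
          ultimately have "((\<lambda>t. t * a (\<gamma> x t) v) has_vector_derivative L x t v) (at t)"
            by (simp add: has_vector_derivative_def L_def algebra_simps)
          then show "((\<lambda>t. t * a (\<gamma> x t) v) has_vector_derivative L x t v) (at t within {0..1})"
            by (rule has_vector_derivative_at_within)
        qed simp
        then show "((\<lambda>t. L x t v) has_integral a x v) (cbox 0 1)"
          by (simp add: \<gamma>_def)
      qed
      finally show ?thesis .
    qed
    then have "blinfun_apply (integral (cbox 0 1) (\<lambda>t. Blinfun (L x t))) = a x" by auto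
    with 1 show ?thesis by simp
  qed
  show ?thesis
    by (rule that[OF deriv smooth_on_derivI[OF \<open>open D\<close> deriv smooth]])
qed

section \<open>Inverse functions of smooth maps\<close>

lemma Ck_on_det:
  fixes M :: "'a::real_normed_vector \<Rightarrow> real ^ 'n ^ 'n"
  assumes "open S" "\<And>i j. Ck_on k S (\<lambda>x. M x $ i $ j)"
  shows "Ck_on k S (\<lambda>x. det (M x))"
  unfolding det_def
  by (intro Ck_on_sum[OF assms(1)] Ck_on_bilinear[OF assms(1) bounded_bilinear_mult] Ck_on_const
      Ck_on_prod[OF assms(1)] assms(2))

text \<open>
  The derivative of the inverse \<open>g\<close> at \<open>y\<close> solves a linear system whose matrix is the Jacobian of
  \<open>G\<close> at \<open>g y\<close>. By Cramer's rule the solution is a rational function of the entries of this matrix,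
  so it is as often differentiable as \<open>g\<close>, and \<open>g\<close> is differentiable once more.
\<close>
lemma smooth_on_inverse_function:
  fixes G g :: "real ^ 'n \<Rightarrow> real ^ 'n"
  assumes "open D" "open V" "smooth_on D G" "g ` V \<subseteq> D"
    and inj: "\<And>x. x \<in> D \<Longrightarrow> inj (frechet_derivative G (at x))"
    and g: "\<And>y. y \<in> V \<Longrightarrow> (g has_derivative g' y) (at y)"
    and g': "\<And>y v. y \<in> V \<Longrightarrow> frechet_derivative G (at (g y)) (g' y v) = v"
  shows "smooth_on V g"
  unfolding smooth_on_def
proof
  define M where "M y = matrix (frechet_derivative G (at (g y)))" for y
  have lin: "linear (frechet_derivative G (at x))" if "x \<in> D" for x
    using smooth_on_derivative[OF assms(3) that] has_derivative_linear by blast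
  have gD: "g y \<in> D" if "y \<in> V" for y using assms(4) that by auto
  have d: "det (M y) \<noteq> 0" if "y \<in> V" for y
    unfolding M_def using det_nz_iff_inj[OF lin[OF gD[OF that]]] inj[OF gD[OF that]] by simp
  have Cr: "g' y v = (\<chi> k. det (\<chi> i j. if j = k then v $ i else M y $ i $ j) / det (M y))"
    if "y \<in> V" for y v
  proof -
    have "M y *v g' y v = v"
      unfolding M_def matrix_vector_mul(2)[OF lin[OF gD[OF that]], THEN fun_cong] by (rule g'[OF that])
    then show ?thesis by (simp only: cramer[OF d[OF that]])
  qed
  fix k
  show "Ck_on k V g"
  proof (induction k)
    case 0
    show ?case
      using g by (auto intro!: continuous_at_imp_continuous_on has_derivative_continuous)
  next
    case (Suc k)
    have M: "Ck_on k V (\<lambda>y. M y $ i $ j)" for i j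
    proof -
      have "smooth_on D (\<lambda>x. frechet_derivative G (at x) (axis j 1) $ i)"
        by (intro smooth_on_vec_nth smooth_on_frechet_derivative assms)
      then have "Ck_on k D (\<lambda>x. frechet_derivative G (at x) (axis j 1) $ i)"
        by (simp add: smooth_on_def)
      from Ck_on_compose[OF \<open>open V\<close> \<open>open D\<close> assms(4) this Suc] show ?thesis
        by (simp add: M_def matrix_def)
    qed
    have e: "Ck_on k V (\<lambda>y. det (\<chi> i j. if j = l then v $ i else M y $ i $ j) * inverse (det (M y)))" for l v
    proof (intro Ck_on_bilinear[OF \<open>open V\<close> bounded_bilinear_mult] Ck_on_det[OF \<open>open V\<close>]
        Ck_on_inverse[OF \<open>open V\<close>] M d)
      show "Ck_on k V (\<lambda>y. (\<chi> i j. if j = l then v $ i else M y $ i $ j) $ i $ j)" for i j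
        by (cases "j = l") (simp_all add: M Ck_on_const)
    qed
    show ?case
    proof (rule Ck_on_SucI[OF \<open>open V\<close> g])
      fix v
      have "Ck_on k V (\<lambda>y. \<Sum>l\<in>UNIV. (det (\<chi> i j. if j = l then v $ i else M y $ i $ j) *
          inverse (det (M y))) *\<^sub>R axis l 1)"
        by (intro Ck_on_sum[OF \<open>open V\<close>] Ck_on_bilinear[OF \<open>open V\<close> bounded_bilinear_scaleR]
            e Ck_on_const)
      then show "Ck_on k V (\<lambda>y. g' y v)"
        by (rule Ck_on_cong[OF \<open>open V\<close>, rotated])
          (auto simp: Cr vec_eq_iff axis_def divide_inverse if_distrib cong: if_cong)
    qed
  qed
qed

theorem smooth_inverse_function_theorem:
  fixes G :: "real ^ 'n \<Rightarrow> real ^ 'n"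
  assumes "open D" "smooth_on D G" "x0 \<in> D"
    and inj: "\<And>x. x \<in> D \<Longrightarrow> inj (frechet_derivative G (at x))"
  obtains U V g where "open U" "U \<subseteq> D" "x0 \<in> U" "open V" "homeomorphism U V G g" "smooth_on V g"
proof -
  define G' where "G' x = Blinfun (frechet_derivative G (at x))" for x
  note der = smooth_on_derivative[OF assms(2)]
  have G': "blinfun_apply (G' x) = frechet_derivative G (at x)" if "x \<in> D" for x
    unfolding G'_def
    by (rule bounded_linear_Blinfun_apply) (use der[OF that] has_derivative_bounded_linear in blast)
  have cont: "continuous_on D G'"
  proof (rule continuous_on_blinfun_componentwise)
    fix i :: "real ^ 'n"
    have "continuous_on D (\<lambda>x. frechet_derivative G (at x) i)"
      by (rule smooth_on_imp_continuous_on[OF smooth_on_frechet_derivative[OF assms(2)]])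
    then show "continuous_on D (\<lambda>x. blinfun_apply (G' x) i)"
      by (rule continuous_on_cong[THEN iffD1, OF refl, rotated]) (simp add: G')
  qed
  have lin: "linear (frechet_derivative G (at x))" if "x \<in> D" for x
    using der[OF that] has_derivative_linear by blast
  obtain h where h: "linear h" "h \<circ> frechet_derivative G (at x0) = id"
    using linear_injective_left_inverse[OF lin inj] assms(3) by blast
  have hb: "blinfun_apply (Blinfun h) = h"
    by (rule bounded_linear_Blinfun_apply) (use h(1) linear_conv_bounded_linear in blast)
  have "Blinfun h o\<^sub>L G' x0 = id_blinfun"
    by (rule blinfun_eqI) (use h(2) in \<open>simp add: hb G'[OF assms(3)] fun_eq_iff\<close>)
  from inverse_function_theorem[OF assms(1) _ cont assms(3) this]
  obtain U V g g' where U: "open U" "U \<subseteq> D" "x0 \<in> U" "open V" "homeomorphism U V G g"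
    and g: "\<And>y. y \<in> V \<Longrightarrow> (g has_derivative g' y) (at y)"
    and g': "\<And>y. y \<in> V \<Longrightarrow> g' y = inv (blinfun_apply (G' (g y)))"
    and bij: "\<And>y. y \<in> V \<Longrightarrow> bij (blinfun_apply (G' (g y)))"
    using der G' by metis
  have gV: "g ` V \<subseteq> D" using U(2,5) homeomorphism_image2 by blast
  have "smooth_on V g"
  proof (rule smooth_on_inverse_function[OF assms(1) U(4) assms(2) gV inj g])
    show "frechet_derivative G (at (g y)) (g' y v) = v" if y: "y \<in> V" for y v
    proof -
      have "blinfun_apply (G' (g y)) (inv (blinfun_apply (G' (g y))) v) = v"
        using bij[OF y] by (simp add: bij_is_surj surj_f_inv_f)
      then show ?thesis using g'[OF y] G'[of "g y"] gV y by auto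
    qed
  qed
  then show ?thesis using U that by blast
qed

section \<open>Integration of the structure equations\<close>

lemma has_derivative_vector_5:
  assumes "(a has_derivative a') (at x)" "(b has_derivative b') (at x)" "(c has_derivative c') (at x)"
    "(d has_derivative d') (at x)" "(e has_derivative e') (at x)"
  shows "((\<lambda>x. vector [a x, b x, c x, d x, e x] :: real ^ 5) has_derivative
    (\<lambda>v. vector [a' v, b' v, c' v, d' v, e' v])) (at x)"
  unfolding has_derivative_componentwise_within[of "\<lambda>x. vector [a x, b x, c x, d x, e x] :: real ^ 5"]
proof
  fix i :: "real ^ 5"
  assume "i \<in> Basis"
  then obtain j where b: "i = axis j 1"
    by (auto simp: Basis_vec_def)
  have "j \<in> {1, 2, 3, 4, 5}" unfolding UNIV_5[symmetric] by simp
  then show "((\<lambda>x. vector [a x, b x, c x, d x, e x] \<bullet> i) has_derivative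
      (\<lambda>v. vector [a' v, b' v, c' v, d' v, e' v] \<bullet> i)) (at x)"
    unfolding b using assms by (auto simp: inner_axis)
qed

lemma smooth_on_vector_5:
  assumes "open S" "smooth_on S a" "smooth_on S b" "smooth_on S c" "smooth_on S d" "smooth_on S e"
  shows "smooth_on S (\<lambda>x. vector [a x, b x, c x, d x, e x] :: real ^ 5)"
proof (rule smooth_on_vec_componentwise[OF assms(1)])
  fix i :: 5
  have "i \<in> {1, 2, 3, 4, 5}" unfolding UNIV_5[symmetric] by simp
  then show "smooth_on S (\<lambda>x. (vector [a x, b x, c x, d x, e x] :: real ^ 5) $ i)"
    using assms by auto
qed

text \<open>The value of \<open>t\<^sub>i \<and> t\<^sub>j\<close> on two vectors.\<close>
definition minor :: "(nat \<Rightarrow> 'a \<Rightarrow> 'a \<Rightarrow> real) \<Rightarrow> nat \<Rightarrow> nat \<Rightarrow> 'a \<Rightarrow> 'a \<Rightarrow> 'a \<Rightarrow> real" where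
  "minor t i j x v w = t i x v * t j x w - t i x w * t j x v"

text \<open>
  Multiplication by the complex number \<open>A + i B\<close>, in real terms, is injective when it is nonzero.
\<close>
lemma kernel_trivial:
  fixes A B :: real
  assumes "A\<^sup>2 + B\<^sup>2 \<noteq> 0" "A * s - B * \<tau> = 0" "B * s + A * \<tau> = 0"
  shows "s = 0" "\<tau> = 0"
proof -
  have "(A\<^sup>2 + B\<^sup>2) * s = A * (A * s - B * \<tau>) + B * (B * s + A * \<tau>)"
    by (simp add: power2_eq_square algebra_simps)
  then have "(A\<^sup>2 + B\<^sup>2) * s = 0" unfolding assms(2,3) by simp
  then show "s = 0" using assms(1) by (metis mult_eq_0_iff)
  have "(A\<^sup>2 + B\<^sup>2) * \<tau> = A * (B * s + A * \<tau>) - B * (A * s - B * \<tau>)"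
    by (simp add: power2_eq_square algebra_simps)
  then have "(A\<^sup>2 + B\<^sup>2) * \<tau> = 0" unfolding assms(2,3) by simp
  then show "\<tau> = 0" using assms(1) by (metis mult_eq_0_iff)
qed

text \<open>
  The equivalence in one chart: the coframing is \<open>t\<close>, and \<open>G'\<close> is the derivative of the map \<open>G\<close> into
  jet space. The last three conclusions are the pullbacks along \<open>G\<close> of the contact form, of its
  exterior derivative and of the 2-form of the equation, expressed by the coframing. The functions
  \<open>S, T, A, B, U, V\<close> in the proof and the forms \<open>s, \<tau>, \<mu>, \<nu>\<close> are those of the sketch above;
  \<open>\<alpha>, \<beta>, \<zeta>\<close> and the primed letters are differentials, written out in the coframing.
\<close>
theorem coframing_normal_form:
  fixes t :: "nat \<Rightarrow> real ^ 5 \<Rightarrow> real ^ 5 \<Rightarrow> real"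
  assumes "open E" "x0 \<in> E"
    and smooth: "\<And>i v. i < 5 \<Longrightarrow> smooth_on E (\<lambda>x. t i x v)"
    and linear: "\<And>i x. i < 5 \<Longrightarrow> x \<in> E \<Longrightarrow> linear (t i x)"
    and indep: "\<And>x v. x \<in> E \<Longrightarrow> (\<And>i. i < 5 \<Longrightarrow> t i x v = 0) \<Longrightarrow> v = 0"
    and d0: "\<And>x v w. x \<in> E \<Longrightarrow> curl (t 0) x v w =
      - 2 * (minor t 1 0 x v w + minor t 3 0 x v w) + minor t 1 2 x v w + minor t 3 4 x v w"
    and d1: "\<And>x v w. x \<in> E \<Longrightarrow> curl (t 1) x v w =
      - minor t 1 4 x v w + minor t 2 4 x v w + minor t 2 3 x v w"
    and d2: "\<And>x v w. x \<in> E \<Longrightarrow> curl (t 2) x v w =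
      - minor t 1 4 x v w + minor t 2 4 x v w + minor t 2 3 x v w - minor t 1 2 x v w + minor t 3 4 x v w"
    and d3: "\<And>x v w. x \<in> E \<Longrightarrow> curl (t 3) x v w =
      minor t 1 4 x v w - minor t 2 4 x v w - minor t 2 3 x v w"
    and d4: "\<And>x v w. x \<in> E \<Longrightarrow> curl (t 4) x v w =
      - minor t 1 4 x v w + minor t 2 4 x v w + minor t 2 3 x v w + minor t 1 2 x v w - minor t 3 4 x v w"
  obtains D V G g G' where "open D" "D \<subseteq> E" "x0 \<in> D" "open V" "V \<subseteq> pde_domain"
    "homeomorphism D V G g" "smooth_on D G" "smooth_on V g"
    "\<And>x. x \<in> D \<Longrightarrow> (G has_derivative G' x) (at x)"
    "\<And>x v. x \<in> D \<Longrightarrow> G' x v $ 3 - G x $ 4 * G' x v $ 1 - G x $ 5 * G' x v $ 2 =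
       ((jet_A (G x))\<^sup>2 + (jet_B (G x))\<^sup>2) / 2 * t 0 x v"
    "\<And>x v w. x \<in> D \<Longrightarrow>
       - (G' x v $ 4 * G' x w $ 1 - G' x w $ 4 * G' x v $ 1)
       - (G' x v $ 5 * G' x w $ 2 - G' x w $ 5 * G' x v $ 2) =
       ((jet_A (G x))\<^sup>2 + (jet_B (G x))\<^sup>2) / 2 * (minor t 1 2 x v w + minor t 3 4 x v w)"
    "\<And>x v w A B. x \<in> D \<Longrightarrow> A = jet_A (G x) \<Longrightarrow> B = jet_B (G x) \<Longrightarrow>
       (A\<^sup>2 - B\<^sup>2) * (G' x v $ 4 * G' x w $ 2 - G' x w $ 4 * G' x v $ 2) +
       4 * A * B * (G' x v $ 1 * G' x w $ 4 - G' x w $ 1 * G' x v $ 4) -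
       (A\<^sup>2 - B\<^sup>2) * (G' x v $ 1 * G' x w $ 5 - G' x w $ 1 * G' x v $ 5) =
       (A\<^sup>2 + B\<^sup>2) * ((A * B - (A\<^sup>2 + B\<^sup>2) / 2) * minor t 1 2 x v w +
         (A * B + (A\<^sup>2 + B\<^sup>2) / 2) * minor t 3 4 x v w)"
proof -
  obtain r where r: "r > 0" "ball x0 r \<subseteq> E" using assms(1,2) open_contains_ball by blast
  define D where "D = ball x0 r"
  have D: "open D" "convex D" "x0 \<in> D" "D \<subseteq> E" using r by (auto simp: D_def)
  have sm: "smooth_on D (\<lambda>x. t i x v)" if "i < 5" for i v
    using smooth_on_subset[OF smooth[OF that] D(4)] .
  have sms: "smooth_on D (\<lambda>x. t 0 x v)" "smooth_on D (\<lambda>x. t 1 x v)" "smooth_on D (\<lambda>x. t 2 x v)"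
    "smooth_on D (\<lambda>x. t 3 x v)" "smooth_on D (\<lambda>x. t 4 x v)" for v
    by (simp_all add: sm)
  have lin: "linear (t i x)" if "x \<in> D" "i < 5" for x i using linear that D(4) by auto
  have tl: "t i x (v + w) = t i x v + t i x w" "t i x (k *\<^sub>R v) = k * t i x v"
    if "x \<in> D" "i < 5" for x v w i k
    using linear_add[OF lin[OF that]] linear_scale[OF lin[OF that]] by auto
  note d = d0[OF subsetD[OF D(4)]] d1[OF subsetD[OF D(4)]] d2[OF subsetD[OF D(4)]]
    d3[OF subsetD[OF D(4)]] d4[OF subsetD[OF D(4)]]
  define s where "s x v = t 1 x v + t 3 x v" for x v
  define \<tau> where "\<tau> x v = t 2 x v + t 4 x v - t 1 x v + t 3 x v" for x v
  define \<mu> where "\<mu> x v = t 1 x v - t 3 x v" for x v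
  define \<nu> where "\<nu> x v = t 4 x v - t 2 x v + t 1 x v + t 3 x v" for x v
  have sm1: "smooth_on D (\<lambda>x. s x v)" "smooth_on D (\<lambda>x. \<tau> x v)" "smooth_on D (\<lambda>x. \<mu> x v)"
    "smooth_on D (\<lambda>x. \<nu> x v)" for v
    unfolding s_def \<tau>_def \<mu>_def \<nu>_def by (intro smooth_on_add[OF D(1)] smooth_on_diff[OF D(1)] sms)+
  have cs: "curl s x v w = 0" and c\<tau>: "curl \<tau> x v w = 0"
    and c\<mu>: "curl \<mu> x v w = 2 * (- minor t 1 4 x v w + minor t 2 4 x v w + minor t 2 3 x v w)"
    and c\<nu>: "curl \<nu> x v w = 2 * (minor t 1 2 x v w - minor t 3 4 x v w)"
    if x: "x \<in> D" for x v w
  proof -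
    have "curl s x v w = curl (t 1) x v w + curl (t 3) x v w"
      unfolding s_def[abs_def] by (rule curl_add[OF sms(2) sms(4) x])
    then show "curl s x v w = 0" unfolding d[OF x] by simp
    have "curl \<tau> x v w = curl (t 2) x v w + curl (t 4) x v w - curl (t 1) x v w + curl (t 3) x v w"
      unfolding \<tau>_def[abs_def]
      by (simp only: curl_add[OF smooth_on_diff[OF D(1) smooth_on_add[OF D(1) sms(3,5)] sms(2)] sms(4) x]
          curl_diff[OF smooth_on_add[OF D(1) sms(3,5)] sms(2) x] curl_add[OF sms(3,5) x])
    then show "curl \<tau> x v w = 0" unfolding d[OF x] by simp
    have "curl \<mu> x v w = curl (t 1) x v w - curl (t 3) x v w"
      unfolding \<mu>_def[abs_def] by (rule curl_diff[OF sms(2) sms(4) x])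
    then show "curl \<mu> x v w = 2 * (- minor t 1 4 x v w + minor t 2 4 x v w + minor t 2 3 x v w)"
      unfolding d[OF x] by simp
    have "curl \<nu> x v w = curl (t 4) x v w - curl (t 2) x v w + curl (t 1) x v w + curl (t 3) x v w"
      unfolding \<nu>_def[abs_def]
      by (simp only: curl_add[OF smooth_on_add[OF D(1) smooth_on_diff[OF D(1) sms(5,3)] sms(2)] sms(4) x]
          curl_add[OF smooth_on_diff[OF D(1) sms(5,3)] sms(2) x] curl_diff[OF sms(5,3) x])
    then show "curl \<nu> x v w = 2 * (minor t 1 2 x v w - minor t 3 4 x v w)"
      unfolding d[OF x] by simp
  qed
  have lin1: "linear (s x)" "linear (\<tau> x)" "linear (\<mu> x)" "linear (\<nu> x)" if "x \<in> D" for x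
    unfolding s_def \<tau>_def \<mu>_def \<nu>_def
    by (rule linearI; simp add: tl[OF that] algebra_simps)+
  have exact: "\<exists>f. (\<forall>x\<in>D. (f has_derivative a x) (at x)) \<and> smooth_on D f"
    if "\<And>v. smooth_on D (\<lambda>x. a x v)" "\<And>x. x \<in> D \<Longrightarrow> linear (a x)"
      "\<And>x v w. x \<in> D \<Longrightarrow> curl a x v w = 0" for a
    by (rule Poincare_1_form[OF D(1,2) that]) auto
  obtain S where S: "\<And>x. x \<in> D \<Longrightarrow> (S has_derivative s x) (at x)"
    using exact[OF sm1(1) lin1(1) cs] by auto
  obtain T where T: "\<And>x. x \<in> D \<Longrightarrow> (T has_derivative \<tau> x) (at x)"
    using exact[OF sm1(2) lin1(2) c\<tau>] by auto
  define A where "A x = exp (S x) * cos (T x)" for x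
  define B where "B x = exp (S x) * sin (T x)" for x
  have R: "(A x)\<^sup>2 + (B x)\<^sup>2 \<noteq> 0" for x
  proof -
    have "(A x)\<^sup>2 + (B x)\<^sup>2 = (exp (S x))\<^sup>2"
      unfolding A_def B_def power_mult_distrib distrib_left[symmetric] by simp
    then show ?thesis by simp
  qed
  define A' where "A' x v = A x * s x v - B x * \<tau> x v" for x v
  define B' where "B' x v = B x * s x v + A x * \<tau> x v" for x v
  have A: "(A has_derivative A' x) (at x)" and B: "(B has_derivative B' x) (at x)" if "x \<in> D" for x
    unfolding A_def[abs_def] B_def[abs_def]
    by (auto intro!: derivative_eq_intros S[OF that] T[OF that]
        simp: A'_def B'_def A_def B_def fun_eq_iff algebra_simps)
  \<comment> \<open>\<open>A\<close> and \<open>B\<close> solve a linear system \<open>dA = A s - B \<tau>, dB = B s + A \<tau>\<close> with smooth coefficients,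
    so each order of differentiability of the pair yields the next.\<close>
  have smAB: "Ck_on k D A \<and> Ck_on k D B" for k
  proof (induction k)
    case 0
    show ?case
      using A B by (auto intro!: continuous_at_imp_continuous_on has_derivative_continuous)
  next
    case (Suc k)
    have c: "Ck_on k D (\<lambda>x. s x v)" "Ck_on k D (\<lambda>x. \<tau> x v)" "Ck_on k D (\<lambda>x. (-1) * \<tau> x v)" for v
      using sm1(1)[of v] sm1(2)[of v] smooth_on_mult[OF D(1) smooth_on_const sm1(2)[of v], of "-1"]
      unfolding smooth_on_def by blast+
    note m = Ck_on_add[OF D(1)] Ck_on_bilinear[OF D(1) bounded_bilinear_mult]
    have "Ck_on k D (\<lambda>x. A x * s x v + B x * ((-1) * \<tau> x v))" "Ck_on k D (\<lambda>x. B x * s x v + A x * \<tau> x v)" for v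
      by (intro m conjunct1[OF Suc] conjunct2[OF Suc] c)+
    then have "Ck_on k D (\<lambda>x. A' x v)" "Ck_on k D (\<lambda>x. B' x v)" for v
      by (simp_all add: A'_def B'_def)
    then show ?case using Ck_on_SucI[OF D(1) A] Ck_on_SucI[OF D(1) B] by blast
  qed
  then have sAB: "smooth_on D A" "smooth_on D B" by (auto simp: smooth_on_def)
  note si = smooth_on_add[OF D(1)] smooth_on_diff[OF D(1)] smooth_on_mult[OF D(1)]
  define \<alpha> where "\<alpha> x v = A x * \<mu> x v - B x * \<nu> x v" for x v
  define \<beta> where "\<beta> x v = B x * \<mu> x v + A x * \<nu> x v" for x v
  have sm2: "smooth_on D (\<lambda>x. \<alpha> x v)" "smooth_on D (\<lambda>x. \<beta> x v)" "smooth_on D (\<lambda>x. A' x v)"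
    "smooth_on D (\<lambda>x. B' x v)" for v
    unfolding \<alpha>_def \<beta>_def A'_def B'_def by (intro si sAB sm1)+
  have lin2: "linear (\<alpha> x)" "linear (\<beta> x)" "linear (A' x)" "linear (B' x)" if "x \<in> D" for x
    unfolding \<alpha>_def \<beta>_def A'_def B'_def
    by (rule linearI; simp add: linear_add[OF lin1(1)[OF that]] linear_scale[OF lin1(1)[OF that]]
      linear_add[OF lin1(2)[OF that]] linear_scale[OF lin1(2)[OF that]]
      linear_add[OF lin1(3)[OF that]] linear_scale[OF lin1(3)[OF that]]
      linear_add[OF lin1(4)[OF that]] linear_scale[OF lin1(4)[OF that]] algebra_simps)+
  have c\<alpha>: "curl \<alpha> x v w = 0" and c\<beta>: "curl \<beta> x v w = 0"
    and cA': "curl A' x v w = 0" and cB': "curl B' x v w = 0" if x: "x \<in> D" for x v w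
  proof -
    note m = curl_mult[OF A[OF x] _ x] curl_mult[OF B[OF x] _ x]
    have "curl \<alpha> x v w = A' x v * \<mu> x w - A' x w * \<mu> x v + A x * curl \<mu> x v w
        - (B' x v * \<nu> x w - B' x w * \<nu> x v + B x * curl \<nu> x v w)"
      unfolding \<alpha>_def[abs_def]
      by (simp only: curl_diff[OF smooth_on_mult[OF D(1) sAB(1) sm1(3)] smooth_on_mult[OF D(1) sAB(2) sm1(4)] x]
          m(1)[OF sm1(3)] m(2)[OF sm1(4)])
    then show "curl \<alpha> x v w = 0"
      unfolding c\<mu>[OF x] c\<nu>[OF x] A'_def B'_def
      unfolding s_def \<tau>_def \<mu>_def \<nu>_def minor_def by (simp add: algebra_simps)
    have "curl \<beta> x v w = B' x v * \<mu> x w - B' x w * \<mu> x v + B x * curl \<mu> x v w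
        + (A' x v * \<nu> x w - A' x w * \<nu> x v + A x * curl \<nu> x v w)"
      unfolding \<beta>_def[abs_def]
      by (simp only: curl_add[OF smooth_on_mult[OF D(1) sAB(2) sm1(3)] smooth_on_mult[OF D(1) sAB(1) sm1(4)] x]
          m(2)[OF sm1(3)] m(1)[OF sm1(4)])
    then show "curl \<beta> x v w = 0"
      unfolding c\<mu>[OF x] c\<nu>[OF x] A'_def B'_def
      unfolding s_def \<tau>_def \<mu>_def \<nu>_def minor_def by (simp add: algebra_simps)
    have "curl A' x v w = A' x v * s x w - A' x w * s x v + A x * curl s x v w
        - (B' x v * \<tau> x w - B' x w * \<tau> x v + B x * curl \<tau> x v w)"
      unfolding A'_def[abs_def]
      by (simp only: curl_diff[OF smooth_on_mult[OF D(1) sAB(1) sm1(1)] smooth_on_mult[OF D(1) sAB(2) sm1(2)] x]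
          m(1)[OF sm1(1)] m(2)[OF sm1(2)] A'_def)
    then show "curl A' x v w = 0"
      unfolding cs[OF x] c\<tau>[OF x] by (simp add: A'_def B'_def algebra_simps)
    have "curl B' x v w = B' x v * s x w - B' x w * s x v + B x * curl s x v w
        + (A' x v * \<tau> x w - A' x w * \<tau> x v + A x * curl \<tau> x v w)"
      unfolding B'_def[abs_def]
      by (simp only: curl_add[OF smooth_on_mult[OF D(1) sAB(2) sm1(1)] smooth_on_mult[OF D(1) sAB(1) sm1(2)] x]
          m(2)[OF sm1(1)] m(1)[OF sm1(2)] B'_def)
    then show "curl B' x v w = 0"
      unfolding cs[OF x] c\<tau>[OF x] by (simp add: A'_def B'_def algebra_simps)
  qed
  obtain U where U: "\<And>x. x \<in> D \<Longrightarrow> (U has_derivative \<alpha> x) (at x)" and sU: "smooth_on D U"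
    using exact[OF sm2(1) lin2(1) c\<alpha>] by auto
  obtain V where V: "\<And>x. x \<in> D \<Longrightarrow> (V has_derivative \<beta> x) (at x)" and sV: "smooth_on D V"
    using exact[OF sm2(2) lin2(2) c\<beta>] by auto
  \<comment> \<open>The linear change of variables that turns \<open>dA \<and> dB - dU \<and> dV\<close> into a multiple of
    \<open>dp \<and> dx + dq \<and> dy\<close> and satisfies \<open>2 p + y = A\<close> and \<open>2 q - x = B\<close>.\<close>
  define X where "X x = 1/2 * (U x - B x)" for x
  define Y where "Y x = 1/2 * (A x + V x)" for x
  define P where "P x = 1/4 * (A x - V x)" for x
  define Q where "Q x = 1/4 * (U x + B x)" for x
  define X' where "X' x v = 1/2 * (\<alpha> x v - B' x v)" for x v
  define Y' where "Y' x v = 1/2 * (A' x v + \<beta> x v)" for x v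
  define P' where "P' x v = 1/4 * (A' x v - \<beta> x v)" for x v
  define Q' where "Q' x v = 1/4 * (\<alpha> x v + B' x v)" for x v
  have XYPQ: "(X has_derivative X' x) (at x)" "(Y has_derivative Y' x) (at x)"
    "(P has_derivative P' x) (at x)" "(Q has_derivative Q' x) (at x)" if "x \<in> D" for x
    unfolding X_def[abs_def] Y_def[abs_def] P_def[abs_def] Q_def[abs_def]
    by (auto intro!: derivative_eq_intros A[OF that] B[OF that] U[OF that] V[OF that]
        simp: X'_def Y'_def P'_def Q'_def fun_eq_iff field_simps)
  have sXYPQ: "smooth_on D X" "smooth_on D Y" "smooth_on D P" "smooth_on D Q"
    unfolding X_def[abs_def] Y_def[abs_def] P_def[abs_def] Q_def[abs_def]
    by (intro si sAB sU sV smooth_on_const)+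
  have sm3: "smooth_on D (\<lambda>x. X' x v)" "smooth_on D (\<lambda>x. Y' x v)" for v
    unfolding X'_def Y'_def by (intro si smooth_on_const sm2)+
  define \<rho> where "\<rho> x = 1/2 * (A x * A x + B x * B x)" for x
  \<comment> \<open>the differential of the future coordinate \<open>z\<close>, chosen so that \<open>dz - p dx - q dy = \<rho> t\<^sub>0\<close>\<close>
  define \<zeta> where "\<zeta> x v = \<rho> x * t 0 x v + P x * X' x v + Q x * Y' x v" for x v
  have \<rho>: "(\<rho> has_derivative (\<lambda>v. 2 * \<rho> x * s x v)) (at x)" if "x \<in> D" for x
    unfolding \<rho>_def[abs_def]
    by (auto intro!: derivative_eq_intros A[OF that] B[OF that]
        simp: A'_def B'_def fun_eq_iff field_simps)
  have s\<rho>: "smooth_on D \<rho>"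
    unfolding \<rho>_def[abs_def] by (intro si sAB smooth_on_const)
  have s\<zeta>: "smooth_on D (\<lambda>x. \<zeta> x v)" for v
    unfolding \<zeta>_def by (intro si s\<rho> sXYPQ sm3 sms)
  have l\<zeta>: "linear (\<zeta> x)" if "x \<in> D" for x
    unfolding \<zeta>_def X'_def Y'_def
    by (rule linearI; simp add: tl[OF that]
      linear_add[OF lin2(1)[OF that]] linear_scale[OF lin2(1)[OF that]]
      linear_add[OF lin2(2)[OF that]] linear_scale[OF lin2(2)[OF that]]
      linear_add[OF lin2(3)[OF that]] linear_scale[OF lin2(3)[OF that]]
      linear_add[OF lin2(4)[OF that]] linear_scale[OF lin2(4)[OF that]] algebra_simps)+
  have dc: "P' x v * X' x w - P' x w * X' x v + (Q' x v * Y' x w - Q' x w * Y' x v) =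
      - (\<rho> x * (minor t 1 2 x v w + minor t 3 4 x v w))" for x v w
    unfolding P'_def Q'_def X'_def Y'_def \<alpha>_def \<beta>_def A'_def B'_def \<rho>_def s_def \<tau>_def \<mu>_def \<nu>_def minor_def
    by (simp add: field_simps)
  have c\<zeta>: "curl \<zeta> x v w = 0" if x: "x \<in> D" for x v w
  proof -
    have cX: "curl X' x v w = 0"
    proof -
      have "curl X' x v w = 1/2 * (curl \<alpha> x v w - curl B' x v w)"
        unfolding X'_def[abs_def]
        by (subst curl_mult[OF has_derivative_const smooth_on_diff[OF D(1) sm2(1,4)] x])
          (simp add: curl_diff[OF sm2(1,4) x])
      then show ?thesis using c\<alpha>[OF x] cB'[OF x] by simp
    qed
    have cY: "curl Y' x v w = 0"
    proof -
      have "curl Y' x v w = 1/2 * (curl A' x v w + curl \<beta> x v w)"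
        unfolding Y'_def[abs_def]
        by (subst curl_mult[OF has_derivative_const smooth_on_add[OF D(1) sm2(3,2)] x])
          (simp add: curl_add[OF sm2(3,2) x])
      then show ?thesis using cA'[OF x] c\<beta>[OF x] by simp
    qed
    note s1 = smooth_on_mult[OF D(1) s\<rho> sms(1)] and s2 = smooth_on_mult[OF D(1) sXYPQ(3) sm3(1)]
      and s3 = smooth_on_mult[OF D(1) sXYPQ(4) sm3(2)]
    have "curl \<zeta> x v w =
      2 * \<rho> x * s x v * t 0 x w - 2 * \<rho> x * s x w * t 0 x v + \<rho> x * curl (t 0) x v w
      + (P' x v * X' x w - P' x w * X' x v + P x * curl X' x v w)
      + (Q' x v * Y' x w - Q' x w * Y' x v + Q x * curl Y' x v w)"
      unfolding \<zeta>_def[abs_def]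
      by (simp only: curl_add[OF smooth_on_add[OF D(1) s1 s2] s3 x] curl_add[OF s1 s2 x]
          curl_mult[OF \<rho>[OF x] sms(1) x] curl_mult[OF XYPQ(3)[OF x] sm3(1) x]
          curl_mult[OF XYPQ(4)[OF x] sm3(2) x])
    also have "\<dots> = 2 * \<rho> x * s x v * t 0 x w - 2 * \<rho> x * s x w * t 0 x v + \<rho> x * curl (t 0) x v w
      - \<rho> x * (minor t 1 2 x v w + minor t 3 4 x v w)"
      using dc[of x v w] cX cY by simp
    also have "\<dots> = 0"
      unfolding d(1)[OF x] s_def minor_def by (simp add: algebra_simps)
    finally show ?thesis .
  qed
  obtain Z where Z: "\<And>x. x \<in> D \<Longrightarrow> (Z has_derivative \<zeta> x) (at x)" and sZ: "smooth_on D Z"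
    using exact[OF s\<zeta> l\<zeta> c\<zeta>] by auto
  define G :: "real ^ 5 \<Rightarrow> real ^ 5" where "G x = vector [X x, Y x, Z x, P x, Q x]" for x
  define G' :: "real ^ 5 \<Rightarrow> real ^ 5 \<Rightarrow> real ^ 5"
    where "G' x v = vector [X' x v, Y' x v, \<zeta> x v, P' x v, Q' x v]" for x v
  have G: "(G has_derivative G' x) (at x)" if "x \<in> D" for x
    unfolding G_def[abs_def] G'_def[abs_def] by (intro has_derivative_vector_5 XYPQ[OF that] Z[OF that])
  have fG: "frechet_derivative G (at x) = G' x" if "x \<in> D" for x
    by (rule frechet_derivative_at[OF G[OF that], symmetric])
  have sG: "smooth_on D G"
    unfolding G_def[abs_def] by (intro smooth_on_vector_5 D(1) sXYPQ sZ)
  have inj: "inj (frechet_derivative G (at x))" if x: "x \<in> D" for x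
  proof -
    have "linear (G' x)" using G[OF x] has_derivative_linear by blast
    moreover have "v = 0" if "G' x v = 0" for v
    proof (rule indep)
      show "x \<in> E" using x D(4) by auto
      have z: "X' x v = 0" "Y' x v = 0" "\<zeta> x v = 0" "P' x v = 0" "Q' x v = 0"
        using arg_cong[OF that, of "\<lambda>u. u $ 1"] arg_cong[OF that, of "\<lambda>u. u $ 2"]
          arg_cong[OF that, of "\<lambda>u. u $ 3"] arg_cong[OF that, of "\<lambda>u. u $ 4"]
          arg_cong[OF that, of "\<lambda>u. u $ 5"]
        by (simp_all add: G'_def)
      \<comment> \<open>The linear change of variables is inverted first, then multiplication by \<open>A + i B\<close>.\<close>
      have "A' x v = 2 * P' x v + Y' x v" "B' x v = 2 * Q' x v - X' x v"
        "\<alpha> x v = 2 * Q' x v + X' x v" "\<beta> x v = Y' x v - 2 * P' x v"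
        by (simp_all add: X'_def Y'_def P'_def Q'_def field_simps)
      then have "A' x v = 0" "B' x v = 0" "\<alpha> x v = 0" "\<beta> x v = 0" using z by simp_all
      then have *: "s x v = 0" "\<tau> x v = 0" "\<mu> x v = 0" "\<nu> x v = 0"
        unfolding A'_def B'_def \<alpha>_def \<beta>_def by - (rule kernel_trivial[OF R]; assumption)+
      have "\<rho> x * t 0 x v = 0" using z by (simp add: \<zeta>_def)
      moreover have "\<rho> x \<noteq> 0" using R[of x] by (simp add: \<rho>_def power2_eq_square)
      ultimately have "t 0 x v = 0" by simp
      moreover have "t 1 x v = 0" "t 2 x v = 0" "t 3 x v = 0" "t 4 x v = 0"
        using * unfolding s_def \<tau>_def \<mu>_def \<nu>_def by linarith+
      ultimately show "t i x v = 0" if "i < 5" for i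
        using that by (auto simp: less_Suc_eq numeral_eq_Suc)
    qed
    ultimately show ?thesis unfolding fG[OF x] by (simp add: linear_injective_0)
  qed
  have jet: "jet_A (G x) = A x" "jet_B (G x) = B x" for x
    by (simp_all add: jet_A_def jet_B_def G_def X_def Y_def P_def Q_def field_simps)
  obtain W N g where W: "open W" "W \<subseteq> D" "x0 \<in> W" "open N" "homeomorphism W N G g" "smooth_on N g"
    by (rule smooth_inverse_function_theorem[OF D(1) sG D(3) inj])
  have N: "N \<subseteq> pde_domain"
  proof
    fix y assume "y \<in> N"
    then obtain x where "y = G x" using W(5) homeomorphism_image1 by blast
    then show "y \<in> pde_domain" using R[of x] by (auto simp: pde_domain_def jet)
  qed
  have \<rho>_eq: "\<rho> x = ((A x)\<^sup>2 + (B x)\<^sup>2) / 2" for x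
    by (simp add: \<rho>_def power2_eq_square)
  show thesis
  proof (rule that[OF W(1) _ W(3,4) N W(5) smooth_on_subset[OF sG W(2)] W(6)])
    show "W \<subseteq> E" using W(2) D(4) by auto
    show "(G has_derivative G' x) (at x)" if "x \<in> W" for x
      using G W(2) that by auto
    show "G' x v $ 3 - G x $ 4 * G' x v $ 1 - G x $ 5 * G' x v $ 2 =
        ((jet_A (G x))\<^sup>2 + (jet_B (G x))\<^sup>2) / 2 * t 0 x v" for x v
      unfolding jet \<rho>_eq[symmetric] by (simp add: G'_def G_def \<zeta>_def)
    show "- (G' x v $ 4 * G' x w $ 1 - G' x w $ 4 * G' x v $ 1)
        - (G' x v $ 5 * G' x w $ 2 - G' x w $ 5 * G' x v $ 2) =
        ((jet_A (G x))\<^sup>2 + (jet_B (G x))\<^sup>2) / 2 * (minor t 1 2 x v w + minor t 3 4 x v w)" for x v w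
      unfolding jet \<rho>_eq[symmetric] using dc[of x v w] by (simp add: G'_def)
    show "(a\<^sup>2 - b\<^sup>2) * (G' x v $ 4 * G' x w $ 2 - G' x w $ 4 * G' x v $ 2) +
        4 * a * b * (G' x v $ 1 * G' x w $ 4 - G' x w $ 1 * G' x v $ 4) -
        (a\<^sup>2 - b\<^sup>2) * (G' x v $ 1 * G' x w $ 5 - G' x w $ 1 * G' x v $ 5) =
        (a\<^sup>2 + b\<^sup>2) * ((a * b - (a\<^sup>2 + b\<^sup>2) / 2) * minor t 1 2 x v w +
          (a * b + (a\<^sup>2 + b\<^sup>2) / 2) * minor t 3 4 x v w)"
      if "a = jet_A (G x)" "b = jet_B (G x)" for x v w a b
      unfolding that jet
      unfolding G'_def vector_5 P'_def Q'_def X'_def Y'_def \<alpha>_def \<beta>_def A'_def B'_def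
        s_def \<tau>_def \<mu>_def \<nu>_def minor_def
      by (simp add: field_simps power2_eq_square)
  qed
qed

section \<open>Wedge products and pullbacks of differential forms\<close>

lemma dforms_onD:
  assumes "\<omega> \<in> dforms_on S"
  shows "x \<notin> S \<Longrightarrow> \<omega> x vs = 0"
    and "x \<in> S \<Longrightarrow> i < length vs \<Longrightarrow> linear (\<lambda>v. \<omega> x (vs[i := v]))"
    and "x \<in> S \<Longrightarrow> i < length vs \<Longrightarrow> j < length vs \<Longrightarrow> i \<noteq> j \<Longrightarrow> vs ! i = vs ! j \<Longrightarrow> \<omega> x vs = 0"
    and "smooth_on S (\<lambda>x. \<omega> x vs)"
  using assms unfolding dforms_on_def by blast+

lemma wedge_pullback: "pullback f (\<alpha> \<and>\<^sub>E \<beta>) = pullback f \<alpha> \<and>\<^sub>E pullback f \<beta>"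
proof (intro ext)
  fix x vs
  let ?L = "frechet_derivative f (at x)"
  have *: "map (\<lambda>i. map ?L vs ! \<sigma> i) is = map ?L (map (\<lambda>i. vs ! \<sigma> i) is)"
    if "\<sigma> permutes {..<length vs}" "set is \<subseteq> {..<length vs}" for \<sigma> "is"
    using permutes_in_image[OF that(1)] that(2) by auto
  show "pullback f (\<alpha> \<and>\<^sub>E \<beta>) x vs = (pullback f \<alpha> \<and>\<^sub>E pullback f \<beta>) x vs"
    unfolding wedge_def pullback_def Let_def length_map
    by (rule sum.cong[OF refl], rule arg_cong2[of _ _ _ _ "(/)", OF _ refl], rule sum.cong[OF refl],
        intro arg_cong2[of _ _ _ _ "(*)"] refl; subst *; auto)
qed

lemma sum_permutes_alternating:
  fixes h :: "'v list \<Rightarrow> real"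
  assumes "i < length vs" "j < length vs" "i \<noteq> j" "vs ! i = vs ! j"
  shows "(\<Sum>\<sigma> | \<sigma> permutes {..<length vs}. of_int (sign \<sigma>) * h (map (\<lambda>i. vs ! \<sigma> i) [0..<length vs])) = 0"
    (is "?s = 0")
proof -
  let ?n = "length vs" and ?\<tau> = "Transposition.transpose i j"
  let ?f = "\<lambda>\<sigma>. of_int (sign \<sigma>) * h (map (\<lambda>i. vs ! \<sigma> i) [0..<length vs])"
  have p: "?\<tau> permutes {..<?n}" using assms by (intro permutes_swap_id) auto
  have "?s = (\<Sum>\<sigma> | \<sigma> permutes {..<?n}. ?f (?\<tau> \<circ> \<sigma>))"
    by (rule setum_permutations_compose_left[OF p])
  also have "\<dots> = (\<Sum>\<sigma> | \<sigma> permutes {..<?n}. - ?f \<sigma>)"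
  proof (rule sum.cong[OF refl])
    fix \<sigma> assume "\<sigma> \<in> {\<sigma>. \<sigma> permutes {..<?n}}"
    then have "permutation \<sigma>" "permutation ?\<tau>"
      using p by (auto intro: permutes_imp_permutation[of "{..<?n}"])
    then have "sign (?\<tau> \<circ> \<sigma>) = - sign \<sigma>"
      by (simp add: sign_compose sign_swap_id assms(3))
    moreover have "vs ! (?\<tau> \<circ> \<sigma>) m = vs ! \<sigma> m" for m
      using assms(4) by (auto simp: Transposition.transpose_def)
    ultimately show "?f (?\<tau> \<circ> \<sigma>) = - ?f \<sigma>" by simp
  qed
  finally show ?thesis by (simp add: sum_negf)
qed

text \<open>
  Linearity: a slot of the argument list is fed to exactly one of the two factors in each summand.
  Alternation: interchanging two slots with equal entries permutes the summands and changes
  their signs.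
\<close>
lemma wedge_dforms_on:
  fixes \<alpha> \<beta> :: "'e::euclidean_space dform"
  assumes "open S" and \<alpha>: "\<alpha> \<in> dforms_on S" and \<beta>: "\<beta> \<in> dforms_on S"
  shows "\<alpha> \<and>\<^sub>E \<beta> \<in> dforms_on S"
proof -
  have 1: "(\<alpha> \<and>\<^sub>E \<beta>) x vs = 0" if "x \<notin> S" for x vs
    using dforms_onD(1)[OF \<alpha> that] by (simp add: wedge_def)
  have 2: "linear (\<lambda>v. (\<alpha> \<and>\<^sub>E \<beta>) x (vs[i := v]))" if x: "x \<in> S" and i: "i < length vs" for x vs i
  proof -
    let ?n = "length vs"
    have term_linear: "linear (\<lambda>v. \<alpha> x (map (\<lambda>j. vs[i := v] ! \<sigma> j) [0..<k]) *
        \<beta> x (map (\<lambda>j. vs[i := v] ! \<sigma> j) [k..<?n]))"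
      if \<sigma>: "\<sigma> permutes {..<?n}" and k: "k \<le> ?n" for \<sigma> k
    proof -
      define l where "l = inv \<sigma> i"
      have l: "l < ?n" "\<sigma> l = i"
        unfolding l_def using permutes_in_image[OF permutes_inv[OF \<sigma>], of i] i
        by (auto simp: permutes_inverses[OF \<sigma>])
      have s: "vs[i := v] ! \<sigma> j = (if j = l then v else vs ! \<sigma> j)" if "j < ?n" for j v
        using permutes_inj[OF \<sigma>] l i by (auto simp: nth_list_update inj_def)
      have m: "map (\<lambda>j. vs[i := v] ! \<sigma> j) [a..<b] =
          (if a \<le> l \<and> l < b then (map (\<lambda>j. vs ! \<sigma> j) [a..<b])[l - a := v] else map (\<lambda>j. vs ! \<sigma> j) [a..<b])"
        if "b \<le> ?n" for a b v
        by (rule nth_equalityI) (use that in \<open>auto simp: s nth_list_update\<close>)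
      show ?thesis
      proof (cases "l < k")
        case True
        have "linear (\<lambda>v. \<alpha> x ((map (\<lambda>j. vs ! \<sigma> j) [0..<k])[l := v]))"
          by (rule dforms_onD(2)[OF \<alpha> x]) (use True in simp)
        then show ?thesis
          unfolding m[OF k] m[OF order_refl] using True
          by (auto simp: linear_iff algebra_simps)
      next
        case False
        have "linear (\<lambda>v. \<beta> x ((map (\<lambda>j. vs ! \<sigma> j) [k..<?n])[l - k := v]))"
          by (rule dforms_onD(2)[OF \<beta> x]) (use False l in simp)
        then show ?thesis
          unfolding m[OF k] m[OF order_refl] using False l
          by (auto simp: linear_iff algebra_simps)
      qed
    qed
    have "(\<lambda>v. (\<alpha> \<and>\<^sub>E \<beta>) x (vs[i := v])) = (\<lambda>v. \<Sum>k\<le>?n. (1 / (fact k * fact (?n - k))) *\<^sub>R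
        (\<Sum>\<sigma> | \<sigma> permutes {..<?n}. of_int (sign \<sigma>) *\<^sub>R
        (\<alpha> x (map (\<lambda>j. vs[i := v] ! \<sigma> j) [0..<k]) * \<beta> x (map (\<lambda>j. vs[i := v] ! \<sigma> j) [k..<?n]))))"
      by (simp add: wedge_def Let_def mult.assoc)
    moreover have "linear \<dots>"
      by (intro linear_compose_sum ballI linear_compose_scale_right term_linear) auto
    ultimately show ?thesis by simp
  qed
  have 3: "(\<alpha> \<and>\<^sub>E \<beta>) x vs = 0"
    if "i < length vs" "j < length vs" "i \<noteq> j" "vs ! i = vs ! j" for x vs i j
    unfolding wedge_def Let_def
  proof (rule sum.neutral, rule ballI)
    fix k assume "k \<in> {..length vs}"
    then have k: "k \<le> length vs" by simp
    have t: "map (\<lambda>i. vs ! \<sigma> i) [0..<k] = take k (map (\<lambda>i. vs ! \<sigma> i) [0..<length vs])"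
      "map (\<lambda>i. vs ! \<sigma> i) [k..<length vs] = drop k (map (\<lambda>i. vs ! \<sigma> i) [0..<length vs])" for \<sigma>
      using k by (simp_all add: take_map drop_map)
    show "(\<Sum>\<sigma> | \<sigma> permutes {..<length vs}. of_int (sign \<sigma>) *
        \<alpha> x (map (\<lambda>i. vs ! \<sigma> i) [0..<k]) * \<beta> x (map (\<lambda>i. vs ! \<sigma> i) [k..<length vs])) /
        (fact k * fact (length vs - k)) = 0"
      unfolding t mult.assoc
      using sum_permutes_alternating[OF that, of "\<lambda>us. \<alpha> x (take k us) * \<beta> x (drop k us)"] by simp
  qed
  have 4: "smooth_on S (\<lambda>x. (\<alpha> \<and>\<^sub>E \<beta>) x vs)" for vs
    unfolding wedge_def Let_def
    by (intro smooth_on_sum[OF assms(1)] smooth_on_divide[OF assms(1)] smooth_on_mult[OF assms(1)]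
        smooth_on_const dforms_onD(4)[OF \<alpha>] dforms_onD(4)[OF \<beta>]) simp
  show ?thesis unfolding dforms_on_def using 1 2 3 4 by auto
qed

text \<open>
  Forms depend smoothly on the point only for fixed vectors. Vector fields are expanded in the
  basis one slot at a time; the list \<open>ws\<close> holds the slots that have already become constant.
\<close>
lemma smooth_on_dform_vector_fields:
  fixes \<omega> :: "'e::euclidean_space dform" and f :: "'d::real_normed_vector \<Rightarrow> 'e"
  assumes "open S" "open T" "\<omega> \<in> dforms_on T" "smooth_on S f" "f ` S \<subseteq> T"
    and "\<And>X. X \<in> set Xs \<Longrightarrow> smooth_on S X"
  shows "smooth_on S (\<lambda>x. \<omega> (f x) (map (\<lambda>X. X x) Xs @ ws))"
  using assms(6)
proof (induction Xs arbitrary: ws rule: rev_induct)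
  case Nil
  show ?case
    using smooth_on_compose[OF assms(1,2,5) dforms_onD(4)[OF assms(3)] assms(4)] by simp
next
  case (snoc X Xs)
  have e: "\<omega> (f x) (map (\<lambda>X. X x) (Xs @ [X]) @ ws) =
      (\<Sum>b\<in>Basis. (X x \<bullet> b) *\<^sub>R \<omega> (f x) (map (\<lambda>X. X x) Xs @ b # ws))" if "x \<in> S" for x
  proof -
    have "f x \<in> T" using assms(5) that by auto
    from dforms_onD(2)[OF assms(3) this, of "length Xs" "map (\<lambda>X. X x) Xs @ 0 # ws"]
    have "linear (\<lambda>v. \<omega> (f x) (map (\<lambda>X. X x) Xs @ v # ws))"
      by (simp add: list_update_append)
    from linear_euclidean_expansion[OF this, of "X x"] show ?thesis by simp
  qed
  have "smooth_on S (\<lambda>x. \<Sum>b\<in>Basis. (X x \<bullet> b) *\<^sub>R \<omega> (f x) (map (\<lambda>X. X x) Xs @ b # ws))"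
    by (rule smooth_on_sum[OF assms(1)], rule smooth_on_bilinear[OF assms(1) bounded_bilinear_scaleR],
        rule smooth_on_bounded_linear[OF assms(1) bounded_linear_inner_left])
      (use snoc in auto)
  then show ?case by (rule smooth_on_cong[OF assms(1), rotated]) (use e in simp)
qed

lemma pullback_dforms_on:
  fixes \<omega> :: "'e::euclidean_space dform" and f :: "'d::euclidean_space \<Rightarrow> 'e"
  assumes "open S" "open T" "\<omega> \<in> dforms_on T" "smooth_on S f" "f ` S \<subseteq> T"
  shows "(\<lambda>x vs. if x \<in> S then pullback f \<omega> x vs else 0) \<in> dforms_on S"
proof -
  have lin: "linear (frechet_derivative f (at x))" if "x \<in> S" for x
    using smooth_on_derivative[OF assms(4) that] has_derivative_linear by blast
  have fx: "f x \<in> T" if "x \<in> S" for x using assms(5) that by auto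
  have 2: "linear (\<lambda>v. pullback f \<omega> x (vs[i := v]))" if "x \<in> S" "i < length vs" for x vs i
    using linear_compose[OF lin[OF that(1)] dforms_onD(2)[OF assms(3) fx[OF that(1)],
        of i "map (frechet_derivative f (at x)) vs"]] that(2)
    by (simp add: pullback_def map_update o_def)
  have 3: "pullback f \<omega> x vs = 0"
    if "x \<in> S" "i < length vs" "j < length vs" "i \<noteq> j" "vs ! i = vs ! j" for x vs i j
    unfolding pullback_def
    by (rule dforms_onD(3)[OF assms(3) fx[OF that(1)], of i _ j]) (use that in auto)
  have 4: "smooth_on S (\<lambda>x. if x \<in> S then pullback f \<omega> x vs else 0)" for vs
  proof -
    have "smooth_on S (\<lambda>x. \<omega> (f x) (map (\<lambda>X. X x) (map (\<lambda>v x. frechet_derivative f (at x) v) vs) @ []))"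
    proof (rule smooth_on_dform_vector_fields[OF assms])
      fix X assume "X \<in> set (map (\<lambda>v x. frechet_derivative f (at x) v) vs)"
      then obtain v where "X = (\<lambda>x. frechet_derivative f (at x) v)" by auto
      then show "smooth_on S X" using smooth_on_frechet_derivative[OF assms(4)] by simp
    qed
    then show ?thesis
      by (rule smooth_on_cong[OF assms(1), rotated]) (simp add: pullback_def o_def)
  qed
  show ?thesis unfolding dforms_on_def using 2 3 4 by auto
qed

lemma dforms_on_restrict:
  assumes "\<omega> \<in> dforms_on S" "T \<subseteq> S" "open T"
  shows "(\<lambda>x vs. if x \<in> T then \<omega> x vs else 0) \<in> dforms_on T"
proof -
  have "smooth_on T (\<lambda>x. if x \<in> T then \<omega> x vs else 0)" for vs
    by (rule smooth_on_cong[OF assms(3) _ smooth_on_subset[OF dforms_onD(4)[OF assms(1)] assms(2)]]) simp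
  then show ?thesis
    using assms(1,2) unfolding dforms_on_def by auto
qed

text \<open>
  Multiplication by a function appears in the ideals as wedge product with a 0-form; here for
  forms whose components have degree 1 or 2.
\<close>
lemma wedge_0_form:
  assumes "\<And>vs. vs \<noteq> [] \<Longrightarrow> \<alpha> x vs = 0"
    and "\<And>vs. length vs \<notin> {1, 2} \<Longrightarrow> \<beta> x vs = 0" "\<And>v w. \<beta> x [v, w] = - \<beta> x [w, v]"
  shows "(\<alpha> \<and>\<^sub>E \<beta>) x vs = \<alpha> x [] * \<beta> x vs"
proof -
  let ?n = "length vs"
  have "(\<alpha> \<and>\<^sub>E \<beta>) x vs = (\<Sum>k\<in>{0}. (\<Sum>\<sigma> | \<sigma> permutes {..<?n}. of_int (sign \<sigma>) *
       \<alpha> x (map (\<lambda>i. vs ! \<sigma> i) [0..<k]) * \<beta> x (map (\<lambda>i. vs ! \<sigma> i) [k..<?n]))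
     / (fact k * fact (?n - k)))"
    unfolding wedge_def Let_def
    by (rule sum.mono_neutral_right) (auto simp: assms(1))
  also have "\<dots> = \<alpha> x [] * \<beta> x vs"
  proof -
    consider "?n \<notin> {1, 2}" | v where "vs = [v]" | v w where "vs = [v, w]"
      by (auto simp: length_Suc_conv numeral_2_eq_2)
    then show ?thesis
    proof cases
      case 1
      then show ?thesis using assms(2)[of vs] by (simp add: assms(2))
    next
      case 2
      have "{\<sigma>. \<sigma> permutes {..<Suc 0}} = {id}" by (auto simp: lessThan_Suc)
      then show ?thesis using 2 by simp
    next
      case (3 v w)
      have P: "{\<sigma>. \<sigma> permutes {..<Suc (Suc 0)}} = {id, Transposition.transpose 0 (Suc 0)}"
        by (auto simp: lessThan_Suc insert_commute permutes_doubleton_iff)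
      have t: "id \<noteq> Transposition.transpose 0 (Suc 0)"
        by (metis id_apply nat.distinct(1) Transposition.transpose_apply_first)
      show ?thesis using 3 t assms(3)[of w v] by (simp add: P sign_swap_id)
    qed
  qed
  finally show ?thesis .
qed

section \<open>Differential forms on manifolds\<close>

lemma smooth_manifold_chart:
  assumes "smooth_manifold X A" "c \<in> A"
  shows "openin X (fst c)" "open (snd c ` fst c)"
    "homeomorphic_map (subtopology X (fst c)) (top_of_set (snd c ` fst c)) (snd c)"
    "fst c \<subseteq> topspace X"
  using assms unfolding smooth_manifold_def by (auto simp: case_prod_beta openin_subset)

lemma chart_inj_on:
  assumes "smooth_manifold X A" "c \<in> A"
  shows "inj_on (snd c) (fst c)"
  using homeomorphic_imp_injective_map[OF smooth_manifold_chart(3)[OF assms]]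
    smooth_manifold_chart(4)[OF assms] by (simp add: Int_absorb1)

lemma chart_image_open:
  assumes "smooth_manifold X A" "c \<in> A" "openin X W"
  shows "open (snd c ` (fst c \<inter> W))"
proof -
  have "open_map (subtopology X (fst c)) (top_of_set (snd c ` fst c)) (snd c)"
    by (rule homeomorphic_imp_open_map[OF smooth_manifold_chart(3)[OF assms(1,2)]])
  moreover have "openin (subtopology X (fst c)) (fst c \<inter> W)"
    using assms(3) by (auto simp: openin_subtopology)
  ultimately have "openin (top_of_set (snd c ` fst c)) (snd c ` (fst c \<inter> W))"
    by (auto simp: open_map_def)
  then show ?thesis
    using smooth_manifold_chart(2)[OF assms(1,2)] openin_open_trans by blast
qed

lemma chart_preimage_open:
  assumes "smooth_manifold X A" "c \<in> A" "open T"
  shows "openin X {m \<in> fst c. snd c m \<in> T}"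
proof -
  have "continuous_map (subtopology X (fst c)) (top_of_set (snd c ` fst c)) (snd c)"
    by (rule homeomorphic_imp_continuous_map[OF smooth_manifold_chart(3)[OF assms(1,2)]])
  moreover have "openin (top_of_set (snd c ` fst c)) (snd c ` fst c \<inter> T)"
    using assms(3) by auto
  ultimately have "openin (subtopology X (fst c))
      {m \<in> topspace (subtopology X (fst c)). snd c m \<in> snd c ` fst c \<inter> T}"
    by (rule openin_continuous_map_preimage)
  moreover have "{m \<in> topspace (subtopology X (fst c)). snd c m \<in> snd c ` fst c \<inter> T} =
      {m \<in> fst c. snd c m \<in> T}"
    using smooth_manifold_chart(4)[OF assms(1,2)] by auto
  ultimately show ?thesis
    using smooth_manifold_chart(1)[OF assms(1,2)] openin_trans_full by metis
qed

lemma transition_smooth: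
  assumes "smooth_manifold X A" "c \<in> A" "d \<in> A"
  shows "smooth_on (snd c ` (fst c \<inter> fst d)) (local_rep c id d)"
proof -
  have "smooth_on (snd c ` (fst c \<inter> topspace X \<inter> id -` fst d)) (local_rep c id d)"
    using assms unfolding smooth_manifold_def smooth_map_def by blast
  moreover have "fst c \<inter> topspace X \<inter> id -` fst d = fst c \<inter> fst d"
    using smooth_manifold_chart(4)[OF assms(1,2)] by auto
  ultimately show ?thesis by simp
qed

lemma local_rep_apply:
  assumes "inj_on (snd c) (fst c)" "m \<in> fst c"
  shows "local_rep c F d (snd c m) = snd d (F m)"
  using assms by (simp add: local_rep_def)

lemma wedge_cong_at: "\<alpha> x = \<alpha>' x \<Longrightarrow> \<beta> x = \<beta>' x \<Longrightarrow> (\<alpha> \<and>\<^sub>E \<beta>) x = (\<alpha>' \<and>\<^sub>E \<beta>') x"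
  by (simp add: wedge_def)

text \<open>
  Families of local representatives that transform correctly under changes of charts, without
  any multilinearity or smoothness. Such a family is determined by one chart that covers \<open>W\<close>
  (\<open>natural_families_eqI\<close> below).
\<close>
definition natural_families :: "('m, 'e::euclidean_space) chart set \<Rightarrow> 'm set \<Rightarrow> ('m, 'e) mform set" where
  "natural_families A W = {\<omega>. (\<forall>c. c \<notin> A \<longrightarrow> \<omega> c = 0) \<and>
     (\<forall>c\<in>A. \<forall>x. x \<notin> snd c ` (fst c \<inter> W) \<longrightarrow> \<omega> c x = 0) \<and> is_pullback A A W id \<omega> \<omega>}"

lemma natural_familiesD:
  assumes "\<omega> \<in> natural_families A W"
  shows "c \<notin> A \<Longrightarrow> \<omega> c = 0"
    and "c \<in> A \<Longrightarrow> x \<notin> snd c ` (fst c \<inter> W) \<Longrightarrow> \<omega> c x = 0"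
    and "c \<in> A \<Longrightarrow> d \<in> A \<Longrightarrow> x \<in> snd c ` (fst c \<inter> W \<inter> id -` fst d) \<Longrightarrow>
      \<omega> c x = pullback (local_rep c id d) (\<omega> d) x"
  using assms unfolding natural_families_def is_pullback_def by blast+

lemma natural_familiesI:
  assumes "\<And>c. c \<notin> A \<Longrightarrow> \<omega> c = 0"
    and "\<And>c x. c \<in> A \<Longrightarrow> x \<notin> snd c ` (fst c \<inter> W) \<Longrightarrow> \<omega> c x = 0"
    and "\<And>c d x. c \<in> A \<Longrightarrow> d \<in> A \<Longrightarrow> x \<in> snd c ` (fst c \<inter> W \<inter> id -` fst d) \<Longrightarrow>
      \<omega> c x = pullback (local_rep c id d) (\<omega> d) x"
  shows "\<omega> \<in> natural_families A W"
  using assms unfolding natural_families_def is_pullback_def by blast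

lemma mforms_iff:
  "\<omega> \<in> mforms A W \<longleftrightarrow>
    \<omega> \<in> natural_families A W \<and> (\<forall>c\<in>A. \<omega> c \<in> dforms_on (snd c ` (fst c \<inter> W)))"
proof -
  have "\<omega> c x = 0" if "\<omega> c \<in> dforms_on (snd c ` (fst c \<inter> W))" "x \<notin> snd c ` (fst c \<inter> W)" for c x
    using dforms_onD(1)[OF that] by (simp add: fun_eq_iff)
  then show ?thesis unfolding mforms_def natural_families_def by blast
qed

lemma natural_families_add:
  assumes "\<alpha> \<in> natural_families A W" "\<beta> \<in> natural_families A W"
  shows "\<alpha> + \<beta> \<in> natural_families A W"
proof (rule natural_familiesI)
  show "(\<alpha> + \<beta>) c x = pullback (local_rep c id d) ((\<alpha> + \<beta>) d) x"
    if "c \<in> A" "d \<in> A" "x \<in> snd c ` (fst c \<inter> W \<inter> id -` fst d)" for c d x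
    using natural_familiesD(3)[OF assms(1) that] natural_familiesD(3)[OF assms(2) that]
    by (simp add: pullback_def fun_eq_iff)
qed (use natural_familiesD[OF assms(1)] natural_familiesD[OF assms(2)] in auto)

lemma natural_families_wedge:
  assumes "\<alpha> \<in> natural_families A W" "\<beta> \<in> natural_families A W"
  shows "\<alpha> \<and>\<^sub>M \<beta> \<in> natural_families A W"
proof (rule natural_familiesI)
  show "(\<alpha> \<and>\<^sub>M \<beta>) c x = pullback (local_rep c id d) ((\<alpha> \<and>\<^sub>M \<beta>) d) x"
    if "c \<in> A" "d \<in> A" "x \<in> snd c ` (fst c \<inter> W \<inter> id -` fst d)" for c d x
    unfolding mwedge_def wedge_pullback
    by (rule wedge_cong_at; rule natural_familiesD(3)[OF _ that]; rule assms)
  show "(\<alpha> \<and>\<^sub>M \<beta>) c x = 0" if "c \<in> A" "x \<notin> snd c ` (fst c \<inter> W)" for c x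
    using natural_familiesD(2)[OF assms(1) that] by (simp add: mwedge_def wedge_def fun_eq_iff)
  show "(\<alpha> \<and>\<^sub>M \<beta>) c = 0" if "c \<notin> A" for c
    using natural_familiesD(1)[OF assms(1) that] by (simp add: mwedge_def wedge_def fun_eq_iff)
qed

lemma natural_families_eqI:
  assumes "\<alpha> \<in> natural_families A W" "\<beta> \<in> natural_families A W" "c0 \<in> A" "W \<subseteq> fst c0"
    and eq: "\<And>x vs. x \<in> snd c0 ` W \<Longrightarrow> \<alpha> c0 x vs = \<beta> c0 x vs"
    and inj: "inj_on (snd c0) (fst c0)" "\<And>c. c \<in> A \<Longrightarrow> inj_on (snd c) (fst c)"
  shows "\<alpha> = \<beta>"
proof (intro ext)
  fix c x vs
  show "\<alpha> c x vs = \<beta> c x vs"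
  proof (cases "c \<in> A \<and> x \<in> snd c ` (fst c \<inter> W)")
    case True
    then obtain m where m: "m \<in> fst c" "m \<in> W" "x = snd c m" by auto
    have "x \<in> snd c ` (fst c \<inter> W \<inter> id -` fst c0)" using m assms(4) by auto
    then have "\<alpha> c x = pullback (local_rep c id c0) (\<alpha> c0) x" "\<beta> c x = pullback (local_rep c id c0) (\<beta> c0) x"
      using True assms(3) natural_familiesD(3)[OF assms(1)] natural_familiesD(3)[OF assms(2)] by metis+
    moreover have "local_rep c id c0 x \<in> snd c0 ` W"
      using local_rep_apply[OF inj(2) m(1), of id c0] True m by simp
    ultimately show ?thesis using eq by (simp add: pullback_def)
  next
    case False
    then have "\<alpha> c x = 0 \<and> \<beta> c x = 0"
      using natural_familiesD(1,2)[OF assms(1)] natural_familiesD(1,2)[OF assms(2)]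
      by (cases "c \<in> A") auto
    then show ?thesis by simp
  qed
qed

lemma mforms_wedge:
  assumes "\<And>c. c \<in> A \<Longrightarrow> open (snd c ` (fst c \<inter> W))" "\<alpha> \<in> mforms A W" "\<beta> \<in> mforms A W"
  shows "\<alpha> \<and>\<^sub>M \<beta> \<in> mforms A W"
  using assms natural_families_wedge[of \<alpha> A W \<beta>]
  by (auto simp: mforms_iff mwedge_def intro: wedge_dforms_on)

lemma mforms_add:
  assumes "\<And>c. c \<in> A \<Longrightarrow> open (snd c ` (fst c \<inter> W))" "\<alpha> \<in> mforms A W" "\<beta> \<in> mforms A W"
  shows "\<alpha> + \<beta> \<in> mforms A W"
proof -
  have "(\<alpha> + \<beta>) c \<in> dforms_on (snd c ` (fst c \<inter> W))" if c: "c \<in> A" for c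
  proof -
    have ab: "\<alpha> c \<in> dforms_on (snd c ` (fst c \<inter> W))" "\<beta> c \<in> dforms_on (snd c ` (fst c \<inter> W))"
      using assms(2,3) c by (auto simp: mforms_iff)
    show ?thesis
      unfolding dforms_on_def
      using dforms_onD(1-3)[OF ab(1)] dforms_onD(1-3)[OF ab(2)]
        smooth_on_add[OF assms(1)[OF c] dforms_onD(4)[OF ab(1)] dforms_onD(4)[OF ab(2)]]
      by (auto intro!: linear_compose_add)
  qed
  then show ?thesis
    using assms natural_families_add[of \<alpha> A W \<beta>] by (simp add: mforms_iff)
qed

lemma zero_mforms: "0 \<in> mforms A W"
  by (auto simp: mforms_iff natural_families_def is_pullback_def pullback_def dforms_on_def
      smooth_on_const fun_eq_iff linear_zero)

lemma mrestrict_mforms: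
  assumes "\<omega> \<in> mforms A W'" "W \<subseteq> W'" "\<And>c. c \<in> A \<Longrightarrow> open (snd c ` (fst c \<inter> W))"
    and inj: "\<And>c. c \<in> A \<Longrightarrow> inj_on (snd c) (fst c)"
  shows "mrestrict W \<omega> \<in> mforms A W"
proof -
  have nat: "\<omega> \<in> natural_families A W'" using assms(1) by (simp add: mforms_iff)
  have "mrestrict W \<omega> c \<in> dforms_on (snd c ` (fst c \<inter> W))" if "c \<in> A" for c
    unfolding mrestrict_def
    by (rule dforms_on_restrict[of _ "snd c ` (fst c \<inter> W')"]) (use assms that in \<open>auto simp: mforms_iff\<close>)
  moreover have "mrestrict W \<omega> \<in> natural_families A W"
  proof (rule natural_familiesI)
    fix c d x assume cd: "c \<in> A" "d \<in> A" and x: "x \<in> snd c ` (fst c \<inter> W \<inter> id -` fst d)"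
    obtain m where m: "m \<in> fst c" "m \<in> W" "m \<in> fst d" "x = snd c m" using x by auto
    have "local_rep c id d x \<in> snd d ` (fst d \<inter> W)"
      using local_rep_apply[OF inj[OF cd(1)] m(1), of id d] m by simp
    moreover have "\<omega> c x = pullback (local_rep c id d) (\<omega> d) x"
      by (rule natural_familiesD(3)[OF nat cd]) (use assms(2) x in auto)
    moreover have "x \<in> snd c ` (fst c \<inter> W)" using m by auto
    ultimately show "mrestrict W \<omega> c x = pullback (local_rep c id d) (mrestrict W \<omega> d) x"
      by (simp add: mrestrict_def pullback_def fun_eq_iff)
  qed (use natural_familiesD(1)[OF nat] in \<open>auto simp: mrestrict_def fun_eq_iff\<close>)
  ultimately show ?thesis by (simp add: mforms_iff)
qed

lemma mrestrict_wedge: "mrestrict W (\<alpha> \<and>\<^sub>M \<beta>) = mrestrict W \<alpha> \<and>\<^sub>M mrestrict W \<beta>"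
  by (intro ext) (simp add: mrestrict_def mwedge_def wedge_def Let_def)

section \<open>Ideals of differential forms\<close>

lemma generated_ideal_subset:
  assumes "G \<subseteq> generated_ideal A W H"
  shows "generated_ideal A W G \<subseteq> generated_ideal A W H"
proof
  fix \<omega> assume "\<omega> \<in> generated_ideal A W G"
  then show "\<omega> \<in> generated_ideal A W H"
  proof induction
    case zero
    show ?case by (rule generated_ideal.zero)
  next
    case (add \<omega> \<eta>)
    show ?case by (rule generated_ideal.add[OF add.IH])
  qed (use assms in \<open>blast intro: generated_ideal.left generated_ideal.right\<close>)+
qed

lemma restrict_generated_ideal:
  assumes "\<And>\<alpha>. \<alpha> \<in> mforms A W' \<Longrightarrow> mrestrict W \<alpha> \<in> mforms A W"
  shows "restrict_ideal A W (generated_ideal A W' G) = generated_ideal A W (mrestrict W ` G)"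
proof -
  have "mrestrict W \<omega> \<in> generated_ideal A W (mrestrict W ` G)" if "\<omega> \<in> generated_ideal A W' G" for \<omega>
    using that
  proof induction
    case zero
    have e: "mrestrict W 0 = 0" by (intro ext) (simp add: mrestrict_def)
    show ?case unfolding e by (rule generated_ideal.zero)
  next
    case (add \<omega> \<eta>)
    have e: "mrestrict W (\<omega> + \<eta>) = mrestrict W \<omega> + mrestrict W \<eta>"
      by (intro ext) (simp add: mrestrict_def)
    show ?case unfolding e by (rule generated_ideal.add[OF add.IH])
  next
    case (left \<alpha> \<omega>)
    show ?case unfolding mrestrict_wedge by (rule generated_ideal.left[OF assms[OF left(1)] left.IH])
  next
    case (right \<alpha> \<omega>)
    show ?case unfolding mrestrict_wedge by (rule generated_ideal.right[OF assms[OF right(1)] right.IH])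
  qed (blast intro: generated_ideal.gen)
  then show ?thesis
    unfolding restrict_ideal_def
    by (intro equalityI generated_ideal_subset) (auto intro: generated_ideal.gen)
qed

lemma generated_ideal_mforms:
  assumes "\<And>c. c \<in> A \<Longrightarrow> open (snd c ` (fst c \<inter> W))" "G \<subseteq> mforms A W"
  shows "generated_ideal A W G \<subseteq> mforms A W"
proof
  fix \<omega> assume "\<omega> \<in> generated_ideal A W G"
  then show "\<omega> \<in> mforms A W"
  proof induction
    case zero
    show ?case by (rule zero_mforms)
  next
    case (add \<omega> \<eta>)
    show ?case by (rule mforms_add[OF assms(1) add.IH])
  next
    case (left \<alpha> \<omega>)
    show ?case by (rule mforms_wedge[OF assms(1) left(1) left.IH])
  next
    case (right \<alpha> \<omega>)
    show ?case by (rule mforms_wedge[OF assms(1) right.IH right(1)])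
  qed (use assms(2) in blast)
qed

text \<open>
  Surjectivity of \<open>P\<close> is needed for the inclusion from right to left, where an arbitrary multiplier on
  the side of \<open>A\<close> has to be the image of one on the side of \<open>B\<close>.
\<close>
lemma generated_ideal_image:
  assumes zero: "P 0 = 0" and add: "\<And>\<omega> \<eta>. P (\<omega> + \<eta>) = P \<omega> + P \<eta>"
    and wedge: "\<And>\<omega> \<eta>. P (\<omega> \<and>\<^sub>M \<eta>) = P \<omega> \<and>\<^sub>M P \<eta>"
    and surj: "P ` mforms B V = mforms A W"
  shows "P ` generated_ideal B V H = generated_ideal A W (P ` H)"
proof (intro equalityI subsetI)
  fix \<omega> assume "\<omega> \<in> P ` generated_ideal B V H"
  then obtain \<eta> where \<eta>: "\<eta> \<in> generated_ideal B V H" "\<omega> = P \<eta>" by auto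
  have "P \<eta> \<in> generated_ideal A W (P ` H)"
    using \<eta>(1)
  proof induction
    case zero
    show ?case unfolding assms(1) by (rule generated_ideal.zero)
  next
    case (add \<omega> \<eta>)
    show ?case unfolding assms(2) by (rule generated_ideal.add[OF add.IH])
  next
    case (left \<alpha> \<omega>)
    have "P \<alpha> \<in> mforms A W" using surj left(1) by blast
    then show ?case unfolding wedge by (rule generated_ideal.left[OF _ left.IH])
  next
    case (right \<alpha> \<omega>)
    have "P \<alpha> \<in> mforms A W" using surj right(1) by blast
    then show ?case unfolding wedge by (rule generated_ideal.right[OF _ right.IH])
  qed (blast intro: generated_ideal.gen)
  then show "\<omega> \<in> generated_ideal A W (P ` H)" using \<eta>(2) by simp
next
  fix \<omega> assume "\<omega> \<in> generated_ideal A W (P ` H)"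
  then show "\<omega> \<in> P ` generated_ideal B V H"
  proof induction
    case zero
    show ?case by (rule image_eqI[of _ P, OF assms(1)[symmetric] generated_ideal.zero])
  next
    case (gen \<omega>)
    then show ?case by (auto intro: generated_ideal.gen)
  next
    case (add \<omega> \<eta>)
    then obtain \<omega>' \<eta>' where *: "\<omega>' \<in> generated_ideal B V H" "\<omega> = P \<omega>'"
      "\<eta>' \<in> generated_ideal B V H" "\<eta> = P \<eta>'"
      by blast
    show ?case
      unfolding *(2,4) assms(2)[symmetric] by (intro imageI generated_ideal.add *)
  next
    case (left \<alpha> \<omega>)
    then obtain \<beta> \<eta> where "\<beta> \<in> mforms B V" "\<alpha> = P \<beta>" "\<eta> \<in> generated_ideal B V H" "\<omega> = P \<eta>"
      using surj by blast
    then show ?case using wedge[of \<beta> \<eta>] generated_ideal.left[of \<beta> B V \<eta> H] by (metis imageI)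
  next
    case (right \<alpha> \<omega>)
    then obtain \<beta> \<eta> where "\<beta> \<in> mforms B V" "\<alpha> = P \<beta>" "\<eta> \<in> generated_ideal B V H" "\<omega> = P \<eta>"
      using surj by blast
    then show ?case using wedge[of \<eta> \<beta>] generated_ideal.right[of \<beta> B V \<eta> H] by (metis imageI)
  qed
qed

section \<open>Identifying forms through a chart\<close>

text \<open>
  An open subset of Euclidean space has only one chart, whose transition map is the identity, and
  this leaves no transformation rule to check.
\<close>
lemma mforms_singleI:
  fixes N :: "'e::euclidean_space set"
  assumes "open N" "V \<subseteq> N" "\<And>c. c \<noteq> (N, id) \<Longrightarrow> \<eta> c = 0" "\<eta> (N, id) \<in> dforms_on V"
  shows "\<eta> \<in> mforms {(N, id)} V"
proof -
  have V: "N \<inter> V = V" using assms(2) by auto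
  have "\<eta> (N, id) x = pullback (local_rep (N, id) id (N, id)) (\<eta> (N, id)) x" if "x \<in> V" for x
  proof -
    have x: "x \<in> N" using that assms(2) by auto
    have eq: "local_rep (N, id) id (N, id) y = id y" if "y \<in> N" for y
      using that f_inv_into_f[of y id N] by (simp add: local_rep_def)
    have "((\<lambda>v. v) has_derivative (\<lambda>v. v)) (at x)" by (rule has_derivative_ident)
    then have "(local_rep (N, id) id (N, id) has_derivative (\<lambda>v. v)) (at x)"
      by (rule has_derivative_transform_within_open[OF _ assms(1) x]) (simp add: eq)
    note e = frechet_derivative_at[OF this, symmetric]
    show ?thesis by (simp add: pullback_def e eq[OF x] fun_eq_iff)
  qed
  moreover have "\<eta> (N, id) x = 0" if "x \<notin> V" for x
    using dforms_onD(1)[OF assms(4) that] by (simp add: fun_eq_iff)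
  ultimately have "\<eta> \<in> natural_families {(N, id)} V"
    by (intro natural_familiesI) (use assms V in auto)
  then show ?thesis using assms(4) V by (simp add: mforms_iff)
qed

text \<open>
  A chart \<open>c0\<close>, followed by a diffeomorphism \<open>G\<close> from an open part \<open>D\<close> of its range onto an open
  subset \<open>V\<close> of \<open>N\<close>, gives a diffeomorphism \<open>F\<close> from \<open>W\<close> onto \<open>V\<close>.
\<close>
locale chart_equivalence =
  fixes X :: "'m topology" and A :: "('m, 'd::euclidean_space) chart set" and c0
    and D :: "'d set" and V N :: "'e::euclidean_space set" and G g
  assumes manifold: "smooth_manifold X A" and c0: "c0 \<in> A"
    and D: "open D" "D \<subseteq> snd c0 ` fst c0"
    and N: "open N" "V \<subseteq> N" and V: "open V"
    and hom: "homeomorphism D V G g"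
    and smooth: "smooth_on D G" "smooth_on V g"
begin

definition W where "W = {m \<in> fst c0. snd c0 m \<in> D}"

definition F where "F = G \<circ> snd c0"

abbreviation chart_range where "chart_range c \<equiv> snd c ` (fst c \<inter> W)"

abbreviation transition where "transition c \<equiv> local_rep c id c0"

text \<open>Pullback along \<open>F\<close> as a function, extended by 0 where forms on \<open>W\<close> vanish by convention.\<close>
definition pull :: "('e, 'e) mform \<Rightarrow> ('m, 'd) mform" where
  "pull \<eta> = (\<lambda>c x vs. if c \<in> A \<and> x \<in> chart_range c
     then pullback (local_rep c F (N, id)) (\<eta> (N, id)) x vs else 0)"

lemma openin_W: "openin X W"
  unfolding W_def by (rule chart_preimage_open[OF manifold c0 D(1)])

lemma W_subset: "W \<subseteq> fst c0" by (auto simp: W_def)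

lemma open_chart_range: "c \<in> A \<Longrightarrow> open (chart_range c)"
  by (rule chart_image_open[OF manifold _ openin_W])

lemma inj: "c \<in> A \<Longrightarrow> inj_on (snd c) (fst c)"
  by (rule chart_inj_on[OF manifold])

lemma chart_range_c0: "chart_range c0 = D" "snd c0 ` W = D"
  using D(2) by (auto simp: W_def)

lemma local_rep_F: "local_rep c F (N, id) = (\<lambda>x. G (transition c x))"
  by (simp add: local_rep_def F_def fun_eq_iff)

lemma trans_in: "c \<in> A \<Longrightarrow> x \<in> chart_range c \<Longrightarrow> transition c x \<in> D"
  using local_rep_apply[OF inj, of c _ id c0] by (auto simp: W_def)

lemma trans_c0:
  assumes "y \<in> D"
  shows "transition c0 y = y"
proof -
  obtain m where "m \<in> fst c0" "y = snd c0 m" using D(2) assms by auto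
  then show ?thesis using local_rep_apply[OF inj[OF c0], of m id c0] by simp
qed

lemma trans_smooth:
  assumes "c \<in> A"
  shows "smooth_on (chart_range c) (transition c)"
  by (rule smooth_on_subset[OF transition_smooth[OF manifold assms c0]]) (use W_subset in auto)

lemma local_rep_F_smooth:
  assumes "c \<in> A"
  shows "smooth_on (chart_range c) (local_rep c F (N, id))"
  unfolding local_rep_F
  by (rule smooth_on_compose[OF open_chart_range[OF assms] D(1) _ smooth(1) trans_smooth[OF assms]])
    (use trans_in[OF assms] in auto)

lemma G_in: "x \<in> D \<Longrightarrow> G x \<in> V" and g_in: "y \<in> V \<Longrightarrow> g y \<in> D"
  and gG: "x \<in> D \<Longrightarrow> g (G x) = x" and Gg: "y \<in> V \<Longrightarrow> G (g y) = y"
  using hom unfolding homeomorphism_def by auto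

lemma local_rep_F_in: "c \<in> A \<Longrightarrow> x \<in> chart_range c \<Longrightarrow> local_rep c F (N, id) x \<in> V"
  unfolding local_rep_F by (intro G_in trans_in)

lemma F_in: "m \<in> W \<Longrightarrow> F m \<in> V"
  using G_in by (auto simp: F_def W_def)

lemma diffeo: "diffeomorphism X A W (top_of_set N) {(N, id)} V F"
proof -
  have "homeomorphic_map (subtopology (subtopology X (fst c0)) W)
      (subtopology (top_of_set (snd c0 ` fst c0)) D) (snd c0)"
    by (rule homeomorphic_map_subtopologies[OF smooth_manifold_chart(3)[OF manifold c0]])
      (use D(2) smooth_manifold_chart(4)[OF manifold c0] in \<open>auto simp: W_def\<close>)
  then have h1: "homeomorphic_map (subtopology X W) (top_of_set D) (snd c0)"
    using W_subset D(2) by (simp add: subtopology_subtopology Int_absorb1)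
  have "homeomorphic_maps (top_of_set D) (top_of_set V) G g"
    using hom unfolding homeomorphism_def homeomorphic_maps_def by auto
  then have h2: "homeomorphic_map (top_of_set D) (top_of_set V) G"
    by (rule homeomorphic_maps_imp_map)
  have hF: "homeomorphic_map (subtopology X W) (subtopology (top_of_set N) V) F"
    using homeomorphic_map_compose[OF h1 h2] N(2) unfolding F_def
    by (simp add: subtopology_subtopology Int_absorb1)
  have s1: "smooth_map A {(N, id)} W F"
  proof -
    have "fst c \<inter> W \<inter> F -` N = fst c \<inter> W" for c :: "('m, 'd) chart" using F_in N(2) by auto
    then show ?thesis using local_rep_F_smooth by (simp add: smooth_map_def)
  qed
  have injF: "inj_on F W"
  proof (rule inj_onI)
    fix m m' assume m: "m \<in> W" "m' \<in> W" "F m = F m'"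
    then have "snd c0 m = snd c0 m'" using gG unfolding F_def W_def by (metis comp_apply mem_Collect_eq)
    then show "m = m'" using inj[OF c0] m W_subset by (auto dest: inj_onD)
  qed
  define h where "h y = inv_into (fst c0) (snd c0) (g y)" for y
  have h: "h y \<in> fst c0" "snd c0 (h y) = g y" if "y \<in> V" for y
    using g_in[OF that] D(2) inv_into_into[of "g y" "snd c0" "fst c0"] f_inv_into_f[of "g y" "snd c0" "fst c0"]
    by (auto simp: h_def)
  have hW: "h y \<in> W" "F (h y) = y" if "y \<in> V" for y
    using h[OF that] g_in[OF that] Gg[OF that] by (auto simp: W_def F_def)
  have inv: "inv_into W F y = h y" if "y \<in> V" for y
    using inv_into_f_f[OF injF hW(1)[OF that]] hW(2)[OF that] by simp
  have s2: "smooth_map {(N, id)} A V (inv_into W F)"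
    unfolding smooth_map_def
  proof (intro ballI)
    fix c :: "('e, 'e) chart" and d assume c: "c \<in> {(N, id)}" and d: "d \<in> A"
    define T where "T = V \<inter> g -` (snd c0 ` (fst c0 \<inter> fst d))"
    have T: "snd c ` (fst c \<inter> V \<inter> inv_into W F -` fst d) = T"
    proof -
      have "g y \<in> snd c0 ` (fst c0 \<inter> fst d) \<longleftrightarrow> h y \<in> fst d" if y: "y \<in> V" for y
      proof
        assume "g y \<in> snd c0 ` (fst c0 \<inter> fst d)"
        then obtain m where m: "m \<in> fst c0" "m \<in> fst d" "g y = snd c0 m" by auto
        then have "h y = m" using h[OF y] inj[OF c0] by (metis inj_onD)
        then show "h y \<in> fst d" using m by simp
      next
        assume "h y \<in> fst d"
        then show "g y \<in> snd c0 ` (fst c0 \<inter> fst d)" using h[OF y] by (metis IntI imageI)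
      qed
      moreover have "fst c = N" "snd c = id" using c by auto
      ultimately show ?thesis using N(2) inv unfolding T_def by auto
    qed
    have oT: "open T"
      unfolding T_def
      by (intro continuous_open_preimage[OF smooth_on_imp_continuous_on[OF smooth(2)] V]
          chart_image_open[OF manifold c0] smooth_manifold_chart(1)[OF manifold d])
    have "smooth_on T (\<lambda>y. local_rep c0 id d (g y))"
      by (rule smooth_on_compose[OF oT _ _ transition_smooth[OF manifold c0 d] smooth_on_subset[OF smooth(2)]])
        (auto simp: T_def chart_image_open[OF manifold c0 smooth_manifold_chart(1)[OF manifold d]])
    then have "smooth_on T (local_rep c (inv_into W F) d)"
    proof (rule smooth_on_cong[OF oT, rotated])
      fix y assume "y \<in> T"
      then have y: "y \<in> V" "y \<in> N" using N(2) by (auto simp: T_def)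
      have "inv_into N id y = y" using f_inv_into_f[of y id N] y by simp
      then show "local_rep c0 id d (g y) = local_rep c (inv_into W F) d y"
        using c inv[OF y(1)] by (simp add: local_rep_def h_def)
    qed
    then show "smooth_on (snd c ` (fst c \<inter> V \<inter> inv_into W F -` fst d)) (local_rep c (inv_into W F) d)"
      unfolding T .
  qed
  show ?thesis unfolding diffeomorphism_def using hF s1 s2 by blast
qed

lemma pull_zero: "pull 0 = 0"
  by (intro ext) (simp add: pull_def pullback_def)

lemma pull_add: "pull (\<omega> + \<eta>) = pull \<omega> + pull \<eta>"
  by (intro ext) (simp add: pull_def pullback_def)

lemma pull_wedge: "pull (\<omega> \<and>\<^sub>M \<eta>) = pull \<omega> \<and>\<^sub>M pull \<eta>"
proof (rule ext, rule ext)
  fix c x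
  show "pull (\<omega> \<and>\<^sub>M \<eta>) c x = (pull \<omega> \<and>\<^sub>M pull \<eta>) c x"
  proof (cases "c \<in> A \<and> x \<in> chart_range c")
    case True
    then have p: "pull \<xi> c x = pullback (local_rep c F (N, id)) (\<xi> (N, id)) x" for \<xi>
      by (simp add: pull_def fun_eq_iff)
    show ?thesis
      unfolding p mwedge_def wedge_pullback by (rule wedge_cong_at; rule p[symmetric])
  next
    case False
    then show ?thesis by (auto simp: pull_def mwedge_def wedge_def fun_eq_iff)
  qed
qed

lemma pull_natural: "pull \<eta> \<in> natural_families A W"
proof (rule natural_familiesI)
  fix c d x assume c: "c \<in> A" and d: "d \<in> A" and x: "x \<in> snd c ` (fst c \<inter> W \<inter> id -` fst d)"
  let ?S = "snd c ` (fst c \<inter> (W \<inter> fst d))"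
  have oS: "open ?S"
    by (rule chart_image_open[OF manifold c openin_Int[OF openin_W smooth_manifold_chart(1)[OF manifold d]]])
  have xS: "x \<in> ?S" "x \<in> chart_range c" using x by auto
  have \<tau>: "local_rep c id d y \<in> chart_range d \<and> transition d (local_rep c id d y) = transition c y"
    if y: "y \<in> ?S" for y
  proof -
    obtain m where m: "m \<in> fst c" "m \<in> W" "m \<in> fst d" "y = snd c m" using y by auto
    show ?thesis
      using local_rep_apply[OF inj[OF c] m(1), of id d] local_rep_apply[OF inj[OF c] m(1), of id c0]
        local_rep_apply[OF inj[OF d] m(3), of id c0] m by auto
  qed
  let ?\<tau> = "local_rep c id d"
  have "?S \<subseteq> snd c ` (fst c \<inter> fst d)" by auto
  then have "smooth_on ?S ?\<tau>"
    by (rule smooth_on_subset[OF transition_smooth[OF manifold c d]])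
  note d1 = smooth_on_derivative[OF this xS(1)]
  note d2 = smooth_on_derivative[OF local_rep_F_smooth[OF d] conjunct1[OF \<tau>[OF xS(1)]]]
  have "(local_rep c F (N, id) has_derivative
      (frechet_derivative (local_rep d F (N, id)) (at (?\<tau> x)) \<circ> frechet_derivative ?\<tau> (at x))) (at x)"
  proof (rule has_derivative_transform_within_open[OF diff_chain_at[OF d1 d2] oS xS(1)])
    fix y assume "y \<in> ?S"
    from \<tau>[OF this] show "(local_rep d F (N, id) \<circ> ?\<tau>) y = local_rep c F (N, id) y"
      unfolding o_apply local_rep_F by metis
  qed
  note e = frechet_derivative_at[OF this, symmetric]
  show "pull \<eta> c x = pullback ?\<tau> (pull \<eta> d) x"
    using c d xS \<tau>[OF xS(1)] by (simp add: pull_def pullback_def e[unfolded local_rep_F] local_rep_F fun_eq_iff)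
qed (auto simp: pull_def fun_eq_iff)

lemma pull_mforms:
  assumes "\<eta> (N, id) \<in> dforms_on V"
  shows "pull \<eta> \<in> mforms A W"
proof -
  have "pull \<eta> c \<in> dforms_on (chart_range c)" if c: "c \<in> A" for c
  proof -
    have "(\<lambda>x vs. if x \<in> chart_range c then pullback (local_rep c F (N, id)) (\<eta> (N, id)) x vs else 0)
        \<in> dforms_on (chart_range c)"
      by (rule pullback_dforms_on[OF open_chart_range[OF c] V assms local_rep_F_smooth[OF c]])
        (use local_rep_F_in[OF c] in blast)
    then show ?thesis using c by (simp add: pull_def)
  qed
  then show ?thesis using pull_natural by (simp add: mforms_iff)
qed

text \<open>A preimage of \<open>\<omega>\<close> is the pullback along \<open>g\<close> of its representative in the chart \<open>c0\<close>.\<close>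
lemma pull_surj: "pull ` mforms {(N, id)} V = mforms A W"
proof (intro equalityI subsetI)
  fix \<omega> assume "\<omega> \<in> pull ` mforms {(N, id)} V"
  then obtain \<eta> where \<eta>: "\<eta> \<in> mforms {(N, id)} V" "\<omega> = pull \<eta>" by auto
  have "N \<inter> V = V" using N(2) by auto
  then have "\<eta> (N, id) \<in> dforms_on V" using \<eta>(1) by (simp add: mforms_iff)
  then show "\<omega> \<in> mforms A W" using pull_mforms \<eta>(2) by simp
next
  fix \<omega> assume \<omega>: "\<omega> \<in> mforms A W"
  define \<eta> :: "('e, 'e) mform" where
    "\<eta> c y vs = (if c = (N, id) \<and> y \<in> V then pullback g (\<omega> c0) y vs else 0)" for c y vs
  have "\<omega> c0 \<in> dforms_on D" using \<omega> c0 chart_range_c0 by (metis mforms_iff)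
  then have "(\<lambda>y vs. if y \<in> V then pullback g (\<omega> c0) y vs else 0) \<in> dforms_on V"
    by (rule pullback_dforms_on[OF V D(1) _ smooth(2)]) (use g_in in auto)
  then have "\<eta> \<in> mforms {(N, id)} V"
    by (intro mforms_singleI N) (auto simp: \<eta>_def[abs_def] fun_eq_iff)
  moreover have "pull \<eta> = \<omega>"
  proof (rule natural_families_eqI[OF pull_natural _ c0 W_subset _ inj[OF c0] inj])
    show "\<omega> \<in> natural_families A W" using \<omega> by (simp add: mforms_iff)
    fix x vs assume "x \<in> snd c0 ` W"
    then have x: "x \<in> D" by (simp add: chart_range_c0)
    have xc: "x \<in> chart_range c0" using x by (simp add: chart_range_c0)
    let ?F = "local_rep c0 F (N, id)"
    note d1 = smooth_on_derivative[OF local_rep_F_smooth[OF c0] xc]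
    note d2 = smooth_on_derivative[OF smooth(2) local_rep_F_in[OF c0 xc]]
    note t = trans_c0
    have "((\<lambda>y. y) has_derivative (frechet_derivative g (at (?F x)) \<circ> frechet_derivative ?F (at x))) (at x)"
    proof (rule has_derivative_transform_within_open[OF diff_chain_at[OF d1 d2] D(1) x])
      fix y assume y: "y \<in> D"
      show "(g \<circ> ?F) y = y" unfolding o_apply local_rep_F t[OF y] by (rule gG[OF y])
    qed
    then have e: "frechet_derivative g (at (?F x)) \<circ> frechet_derivative ?F (at x) = (\<lambda>v. v)"
      using has_derivative_unique has_derivative_ident by blast
    show "pull \<eta> c0 x vs = \<omega> c0 x vs"
      using c0 xc local_rep_F_in[OF c0 xc] x
      by (simp add: pull_def pullback_def \<eta>_def e map_idI) (simp add: local_rep_F t gG)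
  qed (auto intro: inj)
  ultimately show "\<omega> \<in> pull ` mforms {(N, id)} V" by blast
qed

text \<open>In the chart \<open>c0\<close>, pullback along \<open>F\<close> is pullback along \<open>G\<close>; pointwise identities are checked here.\<close>
lemma pull_c0:
  assumes "x \<in> D"
  shows "pull \<eta> c0 x vs = \<eta> (N, id) (G x) (map (frechet_derivative G (at x)) vs)"
proof -
  have "(local_rep c0 F (N, id) has_derivative frechet_derivative G (at x)) (at x)"
    by (rule has_derivative_transform_within_open[OF smooth_on_derivative[OF smooth(1) assms] D(1) assms])
      (simp add: local_rep_F trans_c0)
  from frechet_derivative_at[OF this] show ?thesis
    using c0 assms by (simp add: pull_def chart_range_c0 pullback_def local_rep_F trans_c0)
qed

lemma is_pullback_iff_pull:
  assumes "\<omega> \<in> mforms A W"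
  shows "is_pullback A {(N, id)} W F \<omega> \<eta> \<longleftrightarrow> \<omega> = pull \<eta>"
proof -
  have F: "fst c \<inter> W \<inter> F -` N = fst c \<inter> W" for c :: "('m, 'd) chart" using F_in N(2) by auto
  have nat: "\<omega> \<in> natural_families A W" using assms by (simp add: mforms_iff)
  show ?thesis
  proof
    assume *: "is_pullback A {(N, id)} W F \<omega> \<eta>"
    show "\<omega> = pull \<eta>"
    proof (rule ext, rule ext)
      fix c x
      show "\<omega> c x = pull \<eta> c x"
        using * natural_familiesD(1,2)[OF nat, of c] unfolding is_pullback_def
        by (cases "c \<in> A"; cases "x \<in> chart_range c") (auto simp: F pull_def fun_eq_iff)
    qed
  next
    assume "\<omega> = pull \<eta>"
    then show "is_pullback A {(N, id)} W F \<omega> \<eta>"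
      unfolding is_pullback_def by (auto simp: F pull_def fun_eq_iff)
  qed
qed

lemma pull_eqI:
  assumes "\<alpha> \<in> natural_families A W" "\<beta> \<in> natural_families A W"
    and "\<And>x vs. x \<in> D \<Longrightarrow> \<alpha> c0 x vs = \<beta> c0 x vs"
  shows "\<alpha> = \<beta>"
  by (rule natural_families_eqI[OF assms(1,2) c0 W_subset _ inj[OF c0] inj])
    (use assms(3) in \<open>auto simp: chart_range_c0\<close>)

text \<open>
  The 0-form \<open>k \<circ> F\<close>, used as a multiplier. Taking functions \<open>k\<close> on the target suffices because all
  coefficients below are rational functions of \<open>jet_A\<close> and \<open>jet_B\<close>.
\<close>
definition scalar :: "('e \<Rightarrow> real) \<Rightarrow> ('m, 'd) mform" where
  "scalar k = pull (\<lambda>c y vs. if c = (N, id) \<and> y \<in> V \<and> vs = [] then k y else 0)"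

lemma scalar_mforms:
  assumes "smooth_on V k"
  shows "scalar k \<in> mforms A W"
  unfolding scalar_def
proof (rule pull_mforms)
  have "smooth_on V (\<lambda>y. if y \<in> V then k y else 0)"
    by (rule smooth_on_cong[OF V _ assms]) simp
  then have "smooth_on V (\<lambda>y. if y \<in> V \<and> vs = [] then k y else 0)" for vs :: "'e list"
    by (cases "vs = []") (simp_all add: smooth_on_const)
  then have "(\<lambda>y vs. if y \<in> V \<and> vs = [] then k y else 0) \<in> dforms_on V"
    by (auto simp: dforms_on_def linear_zero)
  then show "(\<lambda>y vs. if (N, id) = (N, id) \<and> y \<in> V \<and> vs = [] then k y else 0) \<in> dforms_on V"
    by simp
qed

text \<open>
  A linear combination with smooth coefficients in the one chart \<open>c0\<close> already holds on \<open>W\<close>, since both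
  sides are natural families. Membership in an ideal can thus be read off from pointwise values.
\<close>
lemma combination_in_ideal:
  assumes nat: "\<alpha> \<in> natural_families A W" "\<beta> \<in> natural_families A W" "\<gamma> \<in> natural_families A W"
    and k: "smooth_on V k" and l: "smooth_on V l"
    and ideal: "\<beta> \<in> generated_ideal A W H" "\<gamma> \<in> generated_ideal A W H"
    and \<beta>: "\<And>x vs. x \<in> D \<Longrightarrow> length vs \<notin> {1, 2} \<Longrightarrow> \<beta> c0 x vs = 0"
      "\<And>x v w. x \<in> D \<Longrightarrow> \<beta> c0 x [v, w] = - \<beta> c0 x [w, v]"
    and \<gamma>: "\<And>x vs. x \<in> D \<Longrightarrow> length vs \<notin> {1, 2} \<Longrightarrow> \<gamma> c0 x vs = 0"
      "\<And>x v w. x \<in> D \<Longrightarrow> \<gamma> c0 x [v, w] = - \<gamma> c0 x [w, v]"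
    and eq: "\<And>x vs. x \<in> D \<Longrightarrow> \<alpha> c0 x vs = k (G x) * \<beta> c0 x vs + l (G x) * \<gamma> c0 x vs"
  shows "\<alpha> \<in> generated_ideal A W H"
proof -
  have s: "scalar h \<in> natural_families A W" for h
    unfolding scalar_def by (rule pull_natural)
  have v: "scalar h c0 x vs = (if vs = [] then h (G x) else 0)" if "x \<in> D" for h x vs
    unfolding scalar_def pull_c0[OF that] using G_in[OF that] by simp
  have m: "(scalar h \<and>\<^sub>M \<eta>) c0 x vs = h (G x) * \<eta> c0 x vs"
    if x: "x \<in> D" and "\<And>vs. length vs \<notin> {1, 2} \<Longrightarrow> \<eta> c0 x vs = 0"
      "\<And>v w. \<eta> c0 x [v, w] = - \<eta> c0 x [w, v]" for h \<eta> x vs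
  proof -
    have "(scalar h c0 \<and>\<^sub>E \<eta> c0) x vs = scalar h c0 x [] * \<eta> c0 x vs"
      by (rule wedge_0_form; (rule that)?) (simp_all add: v[OF x])
    then show ?thesis by (simp add: mwedge_def v[OF x])
  qed
  have "\<alpha> = scalar k \<and>\<^sub>M \<beta> + scalar l \<and>\<^sub>M \<gamma>"
  proof (rule pull_eqI[OF nat(1)])
    show "scalar k \<and>\<^sub>M \<beta> + scalar l \<and>\<^sub>M \<gamma> \<in> natural_families A W"
      by (intro natural_families_add natural_families_wedge s nat)
    show "\<alpha> c0 x vs = (scalar k \<and>\<^sub>M \<beta> + scalar l \<and>\<^sub>M \<gamma>) c0 x vs" if "x \<in> D" for x vs
    proof -
      have "(scalar k \<and>\<^sub>M \<beta>) c0 x vs = k (G x) * \<beta> c0 x vs"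
        by (rule m[OF that]; (rule \<beta>[OF that])?)
      moreover have "(scalar l \<and>\<^sub>M \<gamma>) c0 x vs = l (G x) * \<gamma> c0 x vs"
        by (rule m[OF that]; (rule \<gamma>[OF that])?)
      ultimately show ?thesis by (simp add: eq[OF that])
    qed
  qed
  then show ?thesis
    using generated_ideal.add[OF generated_ideal.left[OF scalar_mforms[OF k] ideal(1)]
        generated_ideal.left[OF scalar_mforms[OF l] ideal(2)]] by simp
qed

text \<open>
  By \<open>generated_ideal_image\<close> the right-hand side is generated by the pullbacks of the generators, so
  equality of the ideals follows from membership of each set of generators in the other ideal.
\<close>
theorem pull_equivalence:
  assumes H: "mrestrict W ` G1 \<subseteq> generated_ideal A W (pull ` mrestrict V ` G2)"
    and H': "pull ` mrestrict V ` G2 \<subseteq> generated_ideal A W (mrestrict W ` G1)"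
    and G1: "G1 \<subseteq> mforms A (topspace X)"
  shows "restrict_ideal A W (generated_ideal A (topspace X) G1) =
    {\<omega> \<in> mforms A W. \<exists>\<eta>\<in>restrict_ideal {(N, id)} V (generated_ideal {(N, id)} N G2).
       is_pullback A {(N, id)} W F \<omega> \<eta>}"
proof -
  have mr: "mrestrict W \<alpha> \<in> mforms A W" if "\<alpha> \<in> mforms A (topspace X)" for \<alpha>
    by (rule mrestrict_mforms[OF that openin_subset[OF openin_W] open_chart_range inj])
  have I: "restrict_ideal A W (generated_ideal A (topspace X) G1) =
      generated_ideal A W (mrestrict W ` G1)"
    by (rule restrict_generated_ideal[OF mr])
  have VN: "N \<inter> V = V" using N(2) by auto
  have J: "restrict_ideal {(N, id)} V (generated_ideal {(N, id)} N G2) =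
      generated_ideal {(N, id)} V (mrestrict V ` G2)"
  proof (rule restrict_generated_ideal)
    fix \<alpha> :: "('e, 'e) mform" assume "\<alpha> \<in> mforms {(N, id)} N"
    then show "mrestrict V \<alpha> \<in> mforms {(N, id)} V"
      by (rule mrestrict_mforms[OF _ N(2)]) (use V VN in auto)
  qed
  have "generated_ideal A W (mrestrict W ` G1) = generated_ideal A W (pull ` mrestrict V ` G2)"
    by (intro equalityI generated_ideal_subset H H')
  also have "\<dots> = pull ` generated_ideal {(N, id)} V (mrestrict V ` G2)"
    by (rule generated_ideal_image[OF pull_zero pull_add pull_wedge pull_surj, symmetric])
  finally have eq: "generated_ideal A W (mrestrict W ` G1) =
      pull ` generated_ideal {(N, id)} V (mrestrict V ` G2)" .
  have "generated_ideal A W (mrestrict W ` G1) \<subseteq> mforms A W"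
    by (rule generated_ideal_mforms[OF open_chart_range]) (use G1 mr in auto)
  then show ?thesis unfolding I J using eq is_pullback_iff_pull by blast
qed

end

section \<open>The Monge-Ampere system and the coframing\<close>

lemma ext_deriv_1_form:
  assumes "x \<in> S"
  shows "ext_deriv S \<omega> x [v, w] = curl (\<lambda>x v. \<omega> x [v]) x v w"
proof -
  have "length [v, w] = Suc (Suc 0)" by simp
  then show ?thesis using assms by (simp add: ext_deriv_def curl_def)
qed

lemma wedge_1_1_degree:
  assumes "\<And>vs. length vs \<noteq> 1 \<Longrightarrow> \<alpha> x vs = 0" and "\<And>vs. length vs \<noteq> 1 \<Longrightarrow> \<beta> x vs = 0"
    and "length vs \<noteq> 2"
  shows "(\<alpha> \<and>\<^sub>E \<beta>) x vs = 0"
  unfolding wedge_def Let_def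
proof (intro sum.neutral ballI)
  fix k assume "k \<in> {..length vs}"
  then have "k \<noteq> 1 \<or> length vs - k \<noteq> 1" using assms(3) by auto
  then have "\<alpha> x (map (\<lambda>i. vs ! \<sigma> i) [0..<k]) * \<beta> x (map (\<lambda>i. vs ! \<sigma> i) [k..<length vs]) = 0" for \<sigma>
    using assms(1)[of "map (\<lambda>i. vs ! \<sigma> i) [0..<k]"] assms(2)[of "map (\<lambda>i. vs ! \<sigma> i) [k..<length vs]"]
    by auto
  then show "(\<Sum>\<sigma> | \<sigma> permutes {..<length vs}. of_int (sign \<sigma>) *
       \<alpha> x (map (\<lambda>i. vs ! \<sigma> i) [0..<k]) * \<beta> x (map (\<lambda>i. vs ! \<sigma> i) [k..<length vs])) /
      (fact k * fact (length vs - k)) = 0"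
    unfolding mult.assoc by (simp only: mult_zero_right sum.neutral_const div_0)
qed

lemma contact_form_apply:
  "contact_form u [v] = v $ 3 - u $ 4 * v $ 1 - u $ 5 * v $ 2"
  "length vs \<noteq> 1 \<Longrightarrow> contact_form u vs = 0"
  by (simp_all add: contact_form_def dcoord_def fscale_def)

lemma ext_deriv_contact_form:
  "ext_deriv UNIV contact_form u [v, w] =
    - (v $ 4 * w $ 1 - w $ 4 * v $ 1) - (v $ 5 * w $ 2 - w $ 5 * v $ 2)"
  "length vs \<noteq> 2 \<Longrightarrow> ext_deriv UNIV contact_form u vs = 0"
proof -
  have "((\<lambda>y. contact_form y [w]) has_derivative (\<lambda>v. - (v $ 4 * w $ 1) - v $ 5 * w $ 2)) (at u)" for w
    unfolding contact_form_apply
    by (auto intro!: derivative_eq_intros bounded_linear_imp_has_derivative[OF bounded_linear_vec_nth])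
  from curl_eqI[OF this] show "ext_deriv UNIV contact_form u [v, w] =
      - (v $ 4 * w $ 1 - w $ 4 * v $ 1) - (v $ 5 * w $ 2 - w $ 5 * v $ 2)"
    by (simp add: ext_deriv_1_form)
  assume vs: "length vs \<noteq> 2"
  have "contact_form y (take i vs @ drop (Suc i) vs) = 0" if "i < length vs" for i y
    by (rule contact_form_apply(2)) (use that vs in auto)
  then show "ext_deriv UNIV contact_form u vs = 0"
    by (simp add: ext_deriv_def)
qed

lemma pde_form_apply:
  "pde_form u [v, w] =
    ((jet_A u)\<^sup>2 - (jet_B u)\<^sup>2) * (v $ 4 * w $ 2 - w $ 4 * v $ 2) +
    4 * jet_A u * jet_B u * (v $ 1 * w $ 4 - w $ 1 * v $ 4) -
    ((jet_A u)\<^sup>2 - (jet_B u)\<^sup>2) * (v $ 1 * w $ 5 - w $ 1 * v $ 5)"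
  "length vs \<noteq> 2 \<Longrightarrow> pde_form u vs = 0"
proof -
  have 1: "dcoord i u vs = 0" if "length vs \<noteq> 1" for i u vs using that by (simp add: dcoord_def)
  show "pde_form u [v, w] =
    ((jet_A u)\<^sup>2 - (jet_B u)\<^sup>2) * (v $ 4 * w $ 2 - w $ 4 * v $ 2) +
    4 * jet_A u * jet_B u * (v $ 1 * w $ 4 - w $ 1 * v $ 4) -
    ((jet_A u)\<^sup>2 - (jet_B u)\<^sup>2) * (v $ 1 * w $ 5 - w $ 1 * v $ 5)"
    by (simp add: pde_form_def monge_ampere_form_def fscale_def wedge_1_1 1)
      (simp add: dcoord_def algebra_simps)
  show "pde_form u vs = 0" if "length vs \<noteq> 2"
    using wedge_1_1_degree[OF 1 1 that] by (simp add: pde_form_def monge_ampere_form_def fscale_def)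
qed

lemma smooth_on_jet: "smooth_on UNIV jet_A" "smooth_on UNIV jet_B"
proof -
  have c: "smooth_on UNIV (\<lambda>u::real ^ 5. u $ i)" for i
    by (rule smooth_on_vec_nth[OF open_UNIV smooth_on_id[OF open_UNIV]])
  show "smooth_on UNIV jet_A" "smooth_on UNIV jet_B"
    unfolding jet_A_def[abs_def] jet_B_def[abs_def]
    by (intro smooth_on_add[OF open_UNIV] smooth_on_diff[OF open_UNIV] smooth_on_mult[OF open_UNIV]
        smooth_on_const c)+
qed

lemma open_pde_domain: "open pde_domain"
proof -
  have eq: "pde_domain = {u. jet_A u \<noteq> 0} \<union> {u. jet_B u \<noteq> 0}" by (auto simp: pde_domain_def)
  show ?thesis
    unfolding eq
    by (intro open_Un open_Collect_neq smooth_on_imp_continuous_on smooth_on_jet continuous_on_const)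
qed

text \<open>
  A coframing is given as linearly independent covectors; in dimension 5 five of them have no
  common zero but 0, since otherwise the map \<open>L\<close> they form would not be onto, and a nonzero vector
  orthogonal to its range would be a linear relation between them.
\<close>
lemma coframing_injective:
  fixes \<theta> :: "nat \<Rightarrow> ('m, real ^ 5) mform"
  assumes "coframing A M \<theta>" "c \<in> A" "x \<in> snd c ` (fst c \<inter> M)"
    and lin: "\<And>i. i < 5 \<Longrightarrow> linear (\<lambda>v. \<theta> i c x [v])"
    and zero: "\<And>i. i < 5 \<Longrightarrow> \<theta> i c x [v] = 0"
  shows "v = 0"
proof (rule ccontr)
  assume "v \<noteq> 0"
  define L :: "real ^ 5 \<Rightarrow> real ^ 5" where
    "L u = vector [\<theta> 0 c x [u], \<theta> 1 c x [u], \<theta> 2 c x [u], \<theta> 3 c x [u], \<theta> 4 c x [u]]" for u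
  have vec5: "a = b" if "\<And>i. i \<in> {1, 2, 3, 4, 5} \<Longrightarrow> a $ i = b $ i" for a b :: "real ^ 5"
    using that UNIV_5 by (simp add: vec_eq_iff)
  have "linear L"
    by (rule linearI; rule vec5)
      (auto simp: L_def linear_add[OF lin] linear_scale[OF lin])
  have "L v = L 0" unfolding L_def by (simp add: zero linear_0[OF lin])
  then have "\<not> inj L" using \<open>v \<noteq> 0\<close> by (auto dest: injD)
  then have "\<not> surj L" using linear_surjective_imp_injective[OF \<open>linear L\<close>] by blast
  then have "span (range L) \<noteq> UNIV"
    using \<open>linear L\<close> by (simp add: linear_subspace_image span_eq_iff[THEN iffD2])
  then obtain a where a: "a \<noteq> 0" "\<And>y. y \<in> span (range L) \<Longrightarrow> a \<bullet> y = 0"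
    using span_not_univ_subset_hyperplane[of "range L"] by blast
  define b where "b i = [a $ 1, a $ 2, a $ 3, a $ 4, a $ 5] ! i" for i
  have b: "b 0 = a $ 1" "b 1 = a $ 2" "b 2 = a $ 3" "b 3 = a $ 4" "b 4 = a $ 5"
    by (simp_all add: b_def)
  have sum_5: "(\<Sum>i\<in>(UNIV :: 5 set). f i) = f 1 + f 2 + f 3 + f 4 + f 5" for f :: "5 \<Rightarrow> real"
    unfolding UNIV_5 by simp
  have "{..<DIM(real ^ 5)} = {0, 1, 2, 3, 4}" by auto
  then have sum_D: "(\<Sum>i<DIM(real ^ 5). f i) = f 0 + f 1 + f 2 + f 3 + f 4" for f :: "nat \<Rightarrow> real"
    by simp
  have "(\<Sum>i<DIM(real ^ 5). b i * \<theta> i c x [u]) = a \<bullet> L u" for u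
    unfolding inner_vec_def sum_5 sum_D b L_def vector_5 by simp
  then have "(\<Sum>i<DIM(real ^ 5). b i * \<theta> i c x [u]) = 0" for u
    using a(2)[OF span_base[OF rangeI, of L u]] by simp
  then have "b i = 0" if "i < 5" for i
    using assms(1-3) that unfolding coframing_def by (auto simp: DIM_cart)
  then have "b 0 = 0" "b 1 = 0" "b 2 = 0" "b 3 = 0" "b 4 = 0" by simp_all
  then have "a = 0" unfolding b by (intro vec5) auto
  with a(1) show False by simp
qed

theorem proposition6p3:
  fixes X :: "'m topology" and A :: "('m, real ^ 5) chart set"
    and \<theta> :: "nat \<Rightarrow> ('m, real ^ 5) mform"
  assumes "smooth_manifold X A"
    and "coframing A (topspace X) \<theta>"
    and "mext_deriv (\<theta> 0) =
      (- 2) *\<^sub>M ((\<theta> 1 + \<theta> 3) \<and>\<^sub>M \<theta> 0) + \<theta> 1 \<and>\<^sub>M \<theta> 2 + \<theta> 3 \<and>\<^sub>M \<theta> 4"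
    and "mext_deriv (\<theta> 1) =
      - (\<theta> 1 \<and>\<^sub>M \<theta> 4) + \<theta> 2 \<and>\<^sub>M \<theta> 4 + \<theta> 2 \<and>\<^sub>M \<theta> 3"
    and "mext_deriv (\<theta> 2) =
      - (\<theta> 1 \<and>\<^sub>M \<theta> 4) + \<theta> 2 \<and>\<^sub>M \<theta> 4 + \<theta> 2 \<and>\<^sub>M \<theta> 3 - \<theta> 1 \<and>\<^sub>M \<theta> 2 + \<theta> 3 \<and>\<^sub>M \<theta> 4"
    and "mext_deriv (\<theta> 3) =
      \<theta> 1 \<and>\<^sub>M \<theta> 4 - \<theta> 2 \<and>\<^sub>M \<theta> 4 - \<theta> 2 \<and>\<^sub>M \<theta> 3"
    and "mext_deriv (\<theta> 4) =
      - (\<theta> 1 \<and>\<^sub>M \<theta> 4) + \<theta> 2 \<and>\<^sub>M \<theta> 4 + \<theta> 2 \<and>\<^sub>M \<theta> 3 + \<theta> 1 \<and>\<^sub>M \<theta> 2 - \<theta> 3 \<and>\<^sub>M \<theta> 4"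
  shows "locally_equivalent
    X A (generated_ideal A (topspace X) {\<theta> 0, \<theta> 1 \<and>\<^sub>M \<theta> 2, \<theta> 3 \<and>\<^sub>M \<theta> 4})
    (top_of_set pde_domain) {(pde_domain, id)} (monge_ampere_ideal pde_domain pde_form)"
  unfolding locally_equivalent_def
proof
  fix m assume m: "m \<in> topspace X"
  let ?N = "pde_domain"
  obtain c0 where c0: "c0 \<in> A" "m \<in> fst c0"
    using assms(1) m unfolding smooth_manifold_def by blast
  define E where "E = snd c0 ` fst c0"
  define t where "t i x v = \<theta> i c0 x [v]" for i x v
  have E: "open E" "snd c0 m \<in> E" "snd c0 ` (fst c0 \<inter> topspace X) = E"
    using smooth_manifold_chart(2,4)[OF assms(1) c0(1)] c0(2) by (auto simp: E_def)
  have \<theta>: "\<theta> i \<in> mforms A (topspace X)" "homogeneous 1 (\<theta> i)" if "i < 5" for i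
    using assms(2) that by (auto simp: coframing_def)
  have df: "\<theta> i c0 \<in> dforms_on E" if "i < 5" for i
    using \<theta>(1)[OF that] c0(1) E(3) mforms_iff by metis
  have hom: "\<theta> i c x vs = 0" if "i < 5" "length vs \<noteq> 1" for i c x vs
    using \<theta>(2)[OF that(1)] that(2) unfolding homogeneous_def by blast
  have lin: "linear (\<lambda>v. \<theta> i c0 x [v])" if "i < 5" "x \<in> E" for i x
    using dforms_onD(2)[OF df[OF that(1)] that(2), of 0 "[0]"] by simp
  have w: "(\<theta> i \<and>\<^sub>M \<theta> j) c x [v, w] = \<theta> i c x [v] * \<theta> j c x [w] - \<theta> i c x [w] * \<theta> j c x [v]"
    if "i < 5" "j < 5" for i j c x v w
    unfolding mwedge_def by (rule wedge_1_1) (use hom that in auto)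
  have w0: "((\<theta> 1 + \<theta> 3) \<and>\<^sub>M \<theta> 0) c x [v, w] =
      (\<theta> 1 c x [v] + \<theta> 3 c x [v]) * \<theta> 0 c x [w] - (\<theta> 1 c x [w] + \<theta> 3 c x [w]) * \<theta> 0 c x [v]" for c x v w
    unfolding mwedge_def by (subst wedge_1_1) (use hom in auto)
  have curl: "curl (t i) x v w = mext_deriv (\<theta> i) c0 x [v, w]" if "x \<in> E" for i x v w
    using that by (simp add: mext_deriv_def E_def ext_deriv_1_form t_def[abs_def])
  have t_smooth: "smooth_on E (\<lambda>x. t i x v)" if "i < 5" for i v
    unfolding t_def by (rule dforms_onD(4)[OF df[OF that]])
  have t_linear: "linear (t i x)" if "i < 5" "x \<in> E" for i x
    using lin[OF that] by (simp add: t_def[abs_def])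
  have t_indep: "v = 0" if "x \<in> E" "\<And>i. i < 5 \<Longrightarrow> t i x v = 0" for x v
    by (rule coframing_injective[OF assms(2) c0(1) _ lin[OF _ that(1)]])
      (use that E(3) in \<open>auto simp: t_def\<close>)
  have wm: "(\<theta> i \<and>\<^sub>M \<theta> j) c0 x [v, w] = minor t i j x v w" if "i < 5" "j < 5" for i j x v w
    unfolding w[OF that] by (simp add: minor_def t_def)
  have wm': "((- 2) *\<^sub>M ((\<theta> 1 + \<theta> 3) \<and>\<^sub>M \<theta> 0)) c0 x [v, w] =
      - 2 * (minor t 1 0 x v w + minor t 3 0 x v w)" for x v w
    unfolding mscale_def w0 by (simp add: minor_def t_def algebra_simps)
  note [simp del] = One_nat_def
  have d0: "curl (t 0) x v w =
      - 2 * (minor t 1 0 x v w + minor t 3 0 x v w) + minor t 1 2 x v w + minor t 3 4 x v w"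
    if "x \<in> E" for x v w
    unfolding curl[OF that] assms(3) plus_fun_apply wm' by (simp add: wm)
  have d1: "curl (t 1) x v w =
      - minor t 1 4 x v w + minor t 2 4 x v w + minor t 2 3 x v w" if "x \<in> E" for x v w
    unfolding curl[OF that] assms(4) by (simp add: wm)
  have d2: "curl (t 2) x v w =
      - minor t 1 4 x v w + minor t 2 4 x v w + minor t 2 3 x v w - minor t 1 2 x v w + minor t 3 4 x v w"
    if "x \<in> E" for x v w
    unfolding curl[OF that] assms(5) by (simp add: wm)
  have d3: "curl (t 3) x v w =
      minor t 1 4 x v w - minor t 2 4 x v w - minor t 2 3 x v w" if "x \<in> E" for x v w
    unfolding curl[OF that] assms(6) by (simp add: wm)
  have d4: "curl (t 4) x v w =
      - minor t 1 4 x v w + minor t 2 4 x v w + minor t 2 3 x v w + minor t 1 2 x v w - minor t 3 4 x v w"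
    if "x \<in> E" for x v w
    unfolding curl[OF that] assms(7) by (simp add: wm)
  obtain D V G g G' where D: "open D" "D \<subseteq> E" "snd c0 m \<in> D" and V: "open V" "V \<subseteq> ?N"
    and G: "homeomorphism D V G g" "smooth_on D G" "smooth_on V g"
    and G': "\<And>x. x \<in> D \<Longrightarrow> (G has_derivative G' x) (at x)"
    and e0: "\<And>x v. x \<in> D \<Longrightarrow> G' x v $ 3 - G x $ 4 * G' x v $ 1 - G x $ 5 * G' x v $ 2 =
       ((jet_A (G x))\<^sup>2 + (jet_B (G x))\<^sup>2) / 2 * t 0 x v"
    and e1: "\<And>x v w. x \<in> D \<Longrightarrow>
       - (G' x v $ 4 * G' x w $ 1 - G' x w $ 4 * G' x v $ 1)
       - (G' x v $ 5 * G' x w $ 2 - G' x w $ 5 * G' x v $ 2) =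
       ((jet_A (G x))\<^sup>2 + (jet_B (G x))\<^sup>2) / 2 * (minor t 1 2 x v w + minor t 3 4 x v w)"
    and e2: "\<And>x v w A B. x \<in> D \<Longrightarrow> A = jet_A (G x) \<Longrightarrow> B = jet_B (G x) \<Longrightarrow>
       (A\<^sup>2 - B\<^sup>2) * (G' x v $ 4 * G' x w $ 2 - G' x w $ 4 * G' x v $ 2) +
       4 * A * B * (G' x v $ 1 * G' x w $ 4 - G' x w $ 1 * G' x v $ 4) -
       (A\<^sup>2 - B\<^sup>2) * (G' x v $ 1 * G' x w $ 5 - G' x w $ 1 * G' x v $ 5) =
       (A\<^sup>2 + B\<^sup>2) * ((A * B - (A\<^sup>2 + B\<^sup>2) / 2) * minor t 1 2 x v w +
         (A * B + (A\<^sup>2 + B\<^sup>2) / 2) * minor t 3 4 x v w)"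
    by (rule coframing_normal_form[OF E(1,2) t_smooth t_linear t_indep d0 d1 d2 d3 d4];
        (rule that; assumption)?)
  interpret ce: chart_equivalence X A c0 D V ?N G g
    by unfold_locales
      (use assms(1) c0(1) D V G open_pde_domain in \<open>auto simp: E_def\<close>)
  let ?W = ce.W
  \<comment> \<open>\<open>a0, a1, a2\<close> generate the given ideal on \<open>W\<close>; \<open>b0, b1, b2\<close> are the pullbacks of the generators
    of the Monge-Ampere ideal.\<close>
  define a0 where "a0 = mrestrict ?W (\<theta> 0)"
  define a1 where "a1 = mrestrict ?W (\<theta> 1 \<and>\<^sub>M \<theta> 2)"
  define a2 where "a2 = mrestrict ?W (\<theta> 3 \<and>\<^sub>M \<theta> 4)"
  define b where "b \<omega> = ce.pull (mrestrict V (euclidean_mform ?N \<omega>))" for \<omega>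
  define b0 where "b0 = b contact_form"
  define b1 where "b1 = b (ext_deriv UNIV contact_form)"
  define b2 where "b2 = b pde_form"
  define H where "H = {a0, a1, a2}"
  define K where "K = {b0, b1, b2}"
  have open_chart: "open (snd c ` (fst c \<inter> topspace X))" if "c \<in> A" for c
    by (rule chart_image_open[OF assms(1) that openin_topspace])
  have gens: "{\<theta> 0, \<theta> 1 \<and>\<^sub>M \<theta> 2, \<theta> 3 \<and>\<^sub>M \<theta> 4} \<subseteq> mforms A (topspace X)"
    using \<theta>(1) by (auto intro!: mforms_wedge open_chart)
  have anat: "a0 \<in> natural_families A ?W" "a1 \<in> natural_families A ?W" "a2 \<in> natural_families A ?W"
    using mrestrict_mforms[OF _ openin_subset[OF ce.openin_W] ce.open_chart_range ce.inj] gens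
    unfolding a0_def a1_def a2_def by (auto simp: mforms_iff)
  have bnat: "b0 \<in> natural_families A ?W" "b1 \<in> natural_families A ?W" "b2 \<in> natural_families A ?W"
    unfolding b0_def b1_def b2_def b_def by (rule ce.pull_natural)+
  have bv: "b \<omega> c0 x vs = \<omega> (G x) (map (G' x) vs)" if "x \<in> D" for \<omega> x vs
  proof -
    have "frechet_derivative G (at x) = G' x" by (rule frechet_derivative_at[OF G'[OF that], symmetric])
    moreover have "G x \<in> V" "G x \<in> ?N" using ce.G_in[OF that] V(2) by auto
    moreover have "?N \<inter> V = V" using V(2) by auto
    ultimately show ?thesis
      by (simp add: b_def ce.pull_c0[OF that] mrestrict_def euclidean_mform_def)
  qed
  have av: "mrestrict ?W \<omega> c0 x vs = \<omega> c0 x vs" if "x \<in> D" for \<omega> x vs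
    using that ce.chart_range_c0 by (simp add: mrestrict_def)
  define \<kappa> where "\<kappa> u = ((jet_A u)\<^sup>2 + (jet_B u)\<^sup>2) / 2" for u
  define \<delta> where "\<delta> u = jet_A u * jet_B u" for u
  have \<kappa>_nz: "\<kappa> u \<noteq> 0" if "u \<in> V" for u
    using that V(2) by (auto simp: \<kappa>_def pde_domain_def sum_power2_eq_zero_iff)
  have va0: "a0 c0 x [v] = t 0 x v" "length vs \<noteq> 1 \<Longrightarrow> a0 c0 x vs = 0" if "x \<in> D" for x v vs
    unfolding a0_def av[OF that] by (simp_all add: t_def hom)
  have va1: "a1 c0 x [v, w] = minor t 1 2 x v w" "length vs \<noteq> 2 \<Longrightarrow> a1 c0 x vs = 0" if "x \<in> D" for x v w vs
    unfolding a1_def av[OF that]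
    by (simp_all add: t_def w minor_def del: One_nat_def)
      (simp add: mwedge_def wedge_1_1_degree hom)
  have va2: "a2 c0 x [v, w] = minor t 3 4 x v w" "length vs \<noteq> 2 \<Longrightarrow> a2 c0 x vs = 0" if "x \<in> D" for x v w vs
    unfolding a2_def av[OF that]
    by (simp_all add: t_def w minor_def)
      (simp add: mwedge_def wedge_1_1_degree hom)
  have vb0: "b0 c0 x [v] = \<kappa> (G x) * t 0 x v" "length vs \<noteq> 1 \<Longrightarrow> b0 c0 x vs = 0" if "x \<in> D" for x v vs
    using e0[OF that, of v] unfolding b0_def bv[OF that]
    by (simp_all add: contact_form_apply \<kappa>_def Let_def)
  have vb1: "b1 c0 x [v, w] = \<kappa> (G x) * (minor t 1 2 x v w + minor t 3 4 x v w)"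
      "length vs \<noteq> 2 \<Longrightarrow> b1 c0 x vs = 0" if "x \<in> D" for x v w vs
    using e1[OF that, of v w] unfolding b1_def bv[OF that]
    by (simp_all add: ext_deriv_contact_form \<kappa>_def Let_def)
  have vb2: "b2 c0 x [v, w] = 2 * \<kappa> (G x) * ((\<delta> (G x) - \<kappa> (G x)) * minor t 1 2 x v w
        + (\<delta> (G x) + \<kappa> (G x)) * minor t 3 4 x v w)"
      "length vs \<noteq> 2 \<Longrightarrow> b2 c0 x vs = 0" if "x \<in> D" for x v w vs
    using e2[OF that refl refl, of v w] unfolding b2_def bv[OF that]
    by (simp_all add: pde_form_apply \<kappa>_def \<delta>_def Let_def)
  have anti: "minor t i j x v w = - minor t i j x w v" for i j x v w
    by (simp add: minor_def)
  have list1: "P vs" if "length vs \<noteq> 1 \<Longrightarrow> P vs" "\<And>v. P [v]" for P and vs :: "(real ^ 5) list"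
    using that by (cases vs; cases "tl vs") auto
  have list2: "P vs" if "length vs \<noteq> 2 \<Longrightarrow> P vs" "\<And>v w. P [v, w]" for P and vs :: "(real ^ 5) list"
    using that by (cases vs; cases "tl vs"; cases "tl (tl vs)") auto
  have one_forms: "\<alpha> \<in> generated_ideal A ?W L"
    if nat: "\<alpha> \<in> natural_families A ?W" "\<beta> \<in> natural_families A ?W"
      and L: "\<beta> \<in> generated_ideal A ?W L" and k: "smooth_on V k"
      and z: "\<And>x vs. x \<in> D \<Longrightarrow> length vs \<noteq> 1 \<Longrightarrow> \<alpha> c0 x vs = 0"
      "\<And>x vs. x \<in> D \<Longrightarrow> length vs \<noteq> 1 \<Longrightarrow> \<beta> c0 x vs = 0"
      and e: "\<And>x v. x \<in> D \<Longrightarrow> \<alpha> c0 x [v] = k (G x) * \<beta> c0 x [v]" for \<alpha> \<beta> L k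
  proof (rule ce.combination_in_ideal[OF nat nat(2) k smooth_on_const L L])
    show "\<alpha> c0 x vs = k (G x) * \<beta> c0 x vs + 0 * \<beta> c0 x vs" if "x \<in> D" for x vs
      by (rule list1[of vs]) (use \<open>x \<in> D\<close> z e in auto)
  qed (use z in auto)
  have two_forms: "\<alpha> \<in> generated_ideal A ?W L"
    if nat: "\<alpha> \<in> natural_families A ?W" "\<beta> \<in> natural_families A ?W" "\<gamma> \<in> natural_families A ?W"
      and L: "\<beta> \<in> generated_ideal A ?W L" "\<gamma> \<in> generated_ideal A ?W L"
      and s: "smooth_on V k" "smooth_on V l"
      and z: "\<And>x vs. x \<in> D \<Longrightarrow> length vs \<noteq> 2 \<Longrightarrow> \<alpha> c0 x vs = 0"
      "\<And>x vs. x \<in> D \<Longrightarrow> length vs \<noteq> 2 \<Longrightarrow> \<beta> c0 x vs = 0"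
      "\<And>x vs. x \<in> D \<Longrightarrow> length vs \<noteq> 2 \<Longrightarrow> \<gamma> c0 x vs = 0"
      and a: "\<And>x v w. x \<in> D \<Longrightarrow> \<beta> c0 x [v, w] = - \<beta> c0 x [w, v]"
      "\<And>x v w. x \<in> D \<Longrightarrow> \<gamma> c0 x [v, w] = - \<gamma> c0 x [w, v]"
      and e: "\<And>x v w. x \<in> D \<Longrightarrow> \<alpha> c0 x [v, w] = k (G x) * \<beta> c0 x [v, w] + l (G x) * \<gamma> c0 x [v, w]"
    for \<alpha> \<beta> \<gamma> L k l
  proof (rule ce.combination_in_ideal[OF nat s L])
    show "\<alpha> c0 x vs = k (G x) * \<beta> c0 x vs + l (G x) * \<gamma> c0 x vs" if "x \<in> D" for x vs
      by (rule list2[of vs]) (use \<open>x \<in> D\<close> z e in auto)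
    show "\<beta> c0 x vs = 0" "\<gamma> c0 x vs = 0" if "x \<in> D" "length vs \<notin> {1, 2}" for x vs
      using z(2,3)[OF that(1), of vs] that(2) by auto
  qed (rule a; assumption)+
  have jets: "smooth_on V jet_A" "smooth_on V jet_B"
    using smooth_on_subset[OF smooth_on_jet(1)] smooth_on_subset[OF smooth_on_jet(2)] by auto
  note si = smooth_on_add[OF V(1)] smooth_on_diff[OF V(1)] smooth_on_mult[OF V(1)] smooth_on_const
    smooth_on_divide[OF V(1)]
  have s: "smooth_on V \<kappa>" "smooth_on V \<delta>"
    unfolding \<kappa>_def[abs_def] \<delta>_def[abs_def] power2_eq_square by (intro si jets; simp)+
  have anti_a: "a1 c0 x [v, w] = - a1 c0 x [w, v]" "a2 c0 x [v, w] = - a2 c0 x [w, v]" if "x \<in> D" for x v w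
    unfolding va1(1)[OF that] va2(1)[OF that] by (rule anti)+
  have anti_b: "b1 c0 x [v, w] = - b1 c0 x [w, v]" "b2 c0 x [v, w] = - b2 c0 x [w, v]" if "x \<in> D" for x v w
    unfolding vb1(1)[OF that] vb2(1)[OF that] anti[of _ _ x v w] by (simp_all add: algebra_simps)
  \<comment> \<open>In the chart, \<open>b0 = \<kappa> a0\<close>, \<open>b1 = \<kappa> (a1 + a2)\<close> and
    \<open>b2 = 2 \<kappa> ((\<delta> - \<kappa>) a1 + (\<delta> + \<kappa>) a2)\<close>. The coefficients of \<open>b1\<close> and \<open>b2\<close> have determinant
    \<open>4 \<kappa>\<^sup>3\<close>, and the coefficients in \<open>HK\<close> are those of the inverse matrix.\<close>
  have KH: "K \<subseteq> generated_ideal A ?W H"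
  proof -
    have i: "a0 \<in> generated_ideal A ?W H" "a1 \<in> generated_ideal A ?W H" "a2 \<in> generated_ideal A ?W H"
      by (auto simp: H_def intro: generated_ideal.gen)
    have "b0 \<in> generated_ideal A ?W H"
      by (rule one_forms[OF bnat(1) anat(1) i(1) s(1)]) (auto simp: va0 vb0)
    moreover have "b1 \<in> generated_ideal A ?W H"
      by (rule two_forms[OF bnat(2) anat(2,3) i(2,3) s(1) s(1) vb1(2) va1(2) va2(2) anti_a])
        (auto simp: va1 va2 vb1 algebra_simps)
    moreover have "b2 \<in> generated_ideal A ?W H"
    proof (rule two_forms[OF bnat(3) anat(2,3) i(2,3) _ _ vb2(2) va1(2) va2(2) anti_a])
      show "smooth_on V (\<lambda>u. 2 * \<kappa> u * (\<delta> u - \<kappa> u))" "smooth_on V (\<lambda>u. 2 * \<kappa> u * (\<delta> u + \<kappa> u))"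
        by (intro si s)+
    qed (auto simp: va1 va2 vb2 algebra_simps)
    ultimately show ?thesis by (simp add: K_def)
  qed
  have HK: "H \<subseteq> generated_ideal A ?W K"
  proof -
    have i: "b0 \<in> generated_ideal A ?W K" "b1 \<in> generated_ideal A ?W K" "b2 \<in> generated_ideal A ?W K"
      by (auto simp: K_def intro: generated_ideal.gen)
    have nz: "\<kappa> (G x) \<noteq> 0" if "x \<in> D" for x using \<kappa>_nz ce.G_in that by blast
    have "a0 \<in> generated_ideal A ?W K"
    proof (rule one_forms[OF anat(1) bnat(1) i(1)])
      show "smooth_on V (\<lambda>u. 1 / \<kappa> u)" by (intro si s \<kappa>_nz)
    qed (auto simp: va0 vb0 nz)
    moreover have "a1 \<in> generated_ideal A ?W K"
    proof (rule two_forms[OF anat(2) bnat(2,3) i(2,3) _ _ va1(2) vb1(2) vb2(2) anti_b])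
      show "smooth_on V (\<lambda>u. (\<delta> u + \<kappa> u) / (2 * (\<kappa> u * \<kappa> u)))"
        "smooth_on V (\<lambda>u. (-1) / (4 * (\<kappa> u * \<kappa> u)))"
        by (intro si s; simp add: \<kappa>_nz)+
    qed (auto simp: va1 vb1 vb2 nz field_simps)
    moreover have "a2 \<in> generated_ideal A ?W K"
    proof (rule two_forms[OF anat(3) bnat(2,3) i(2,3) _ _ va2(2) vb1(2) vb2(2) anti_b])
      show "smooth_on V (\<lambda>u. (\<kappa> u - \<delta> u) / (2 * (\<kappa> u * \<kappa> u)))"
        "smooth_on V (\<lambda>u. 1 / (4 * (\<kappa> u * \<kappa> u)))"
        by (intro si s; simp add: \<kappa>_nz)+
    qed (auto simp: va2 vb1 vb2 nz field_simps)
    ultimately show ?thesis by (simp add: H_def)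
  qed
  let ?G2 = "euclidean_mform ?N ` {contact_form, ext_deriv UNIV contact_form, pde_form}"
  have K_eq: "ce.pull ` mrestrict V ` ?G2 = K"
    by (simp add: K_def b0_def b1_def b2_def b_def)
  have H_eq: "H = mrestrict ?W ` {\<theta> 0, \<theta> 1 \<and>\<^sub>M \<theta> 2, \<theta> 3 \<and>\<^sub>M \<theta> 4}"
    by (simp add: H_def a0_def a1_def a2_def)
  have "m \<in> ?W" using c0 D(3) by (simp add: ce.W_def)
  moreover have "openin (top_of_set ?N) V" using V openin_open_eq[OF open_pde_domain] by auto
  ultimately show "\<exists>W V F. m \<in> W \<and> openin X W \<and> openin (top_of_set ?N) V \<and>
      diffeomorphism X A W (top_of_set ?N) {(?N, id)} V F \<and>
      restrict_ideal A W (generated_ideal A (topspace X) {\<theta> 0, \<theta> 1 \<and>\<^sub>M \<theta> 2, \<theta> 3 \<and>\<^sub>M \<theta> 4}) =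
        {\<omega> \<in> mforms A W. \<exists>\<eta>\<in>restrict_ideal {(?N, id)} V (monge_ampere_ideal ?N pde_form).
           is_pullback A {(?N, id)} W F \<omega> \<eta>}"
    using ce.openin_W ce.diffeo
      ce.pull_equivalence[OF HK[folded K_eq, unfolded H_eq] KH[folded K_eq, unfolded H_eq] gens,
        folded monge_ampere_ideal_def]
    by blast
qed

end
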